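(* Logical equivalence is complete for $\Sigma^0_1$ equivalence relations. That is, the relation $\{(\varphi,\psi) : \ \vdash_{FOL}\varphi\leftrightarrow\psi\}$ on formulae of first order logic is a $\Sigma^0_1$ equivalence relation, and for every $\Sigma^0_1$ equivalence relation $E$ on $\mathbb{N}$ there exists a computable function $f$ mapping natural numbers to first order formulae such that for all $x,y\in\mathbb{N}$: $$(x,y)\in E\iff\ \vdash_{FOL} f(x)\leftrightarrow f(y).$$
   Context: First order logic (FOL) is taken with a full relational signature, i.e. with predicate symbols of every arity (as many as needed, computably presented). $\vdash_{FOL}\varphi$ means that $\varphi$ has a proof in first order logic. Formulae are identified with natural numbers via a fixed computable encoding, so relations on formulae are regarded as subsets of $\mathbb{N}\times\mathbb{N}$. A $\Sigma^0_1$ equivalence relation is an equivalence relation on $\mathbb{N}$ that is recursively enumerable as a set of pairs. For binary relations $A,B$ on $\mathbb{N}$, $A\le B$ (computable component-wise reducibility) means that there is a computable $f:\mathbb{N}\to\mathbb{N}$ with $(x,y)\in A\iff (f(x),f(y))\in B$ for all $x,y$. An equivalence relation is complete for $\Sigma^0_1$ equivalence relations if it is $\Sigma^0_1$ and every $\Sigma^0_1$ equivalence relation on $\mathbb{N}$ is $\le$ it. *)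

theory Defs
  imports Main "HOL-Library.Nat_Bijection"
begin

section \<open>Partial recursive functions\<close>

datatype recf =
    Zero
  | Succ
  | Proj nat
  | Comp recf "recf list"
  | PrimRec recf recf
  | Mu recf

text \<open>
  \<open>rec_eval f xs y\<close>: the partial function denoted by \<open>f\<close> is defined at the argument tuple
  \<open>xs\<close> and has the value \<open>y\<close> there. The arity is the length of the argument list: one term
  denotes a partial function of each arity, with no value at tuples of an unsuitable length.
  Restricted to a fixed arity, the functions denoted are exactly the partial recursive ones.
  The recursion variable and the variable searched over come first.
\<close>

inductive rec_eval :: "recf \<Rightarrow> nat list \<Rightarrow> nat \<Rightarrow> bool" where
  zero: "rec_eval Zero xs 0"
| succ: "rec_eval Succ [x] (Suc x)"
| proj: "i < length xs \<Longrightarrow> rec_eval (Proj i) xs (xs ! i)"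
| comp: "list_all2 (\<lambda>g y. rec_eval g xs y) gs ys \<Longrightarrow> rec_eval f ys z \<Longrightarrow> rec_eval (Comp f gs) xs z"
| primrec_0: "rec_eval f xs y \<Longrightarrow> rec_eval (PrimRec f g) (0 # xs) y"
| primrec_Suc: "rec_eval (PrimRec f g) (n # xs) y \<Longrightarrow> rec_eval g (n # y # xs) z
    \<Longrightarrow> rec_eval (PrimRec f g) (Suc n # xs) z"
| mu: "rec_eval f (n # xs) 0 \<Longrightarrow> (\<forall>m<n. \<exists>k. rec_eval f (m # xs) (Suc k))
    \<Longrightarrow> rec_eval (Mu f) xs n"

lemma rec_eval_deterministic: "rec_eval f xs y \<Longrightarrow> rec_eval f xs z \<Longrightarrow> y = z"
proof (induction f xs y arbitrary: z rule: rec_eval.induct)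
  case (comp xs gs ys f w)
  from comp.prems obtain ys' where ys': "list_all2 (\<lambda>g y. rec_eval g xs y) gs ys'"
    and f: "rec_eval f ys' z"
    by (cases rule: rec_eval.cases) auto
  have "ys = ys'"
    using comp.IH(1) ys' by (auto simp: list_all2_conv_all_nth intro: nth_equalityI)
  with comp.IH(2) f show ?case by simp
next
  case (primrec_0 f xs y g)
  from primrec_0.prems show ?case
    by (cases rule: rec_eval.cases) (use primrec_0.IH in auto)
next
  case (primrec_Suc f g n xs y w)
  from primrec_Suc.prems show ?case
    by (cases rule: rec_eval.cases) (use primrec_Suc.IH in auto)
next
  case (mu f n xs)
  from mu.prems have z: "rec_eval f (z # xs) 0" "\<forall>m<z. \<exists>k. rec_eval f (m # xs) (Suc k)"
    by (cases rule: rec_eval.cases; simp)+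
  show ?case
  proof (cases n z rule: linorder_cases)
    case less
    with z(2) mu.IH(1) show ?thesis by blast
  next
    case greater
    with z(1) mu.IH(2) show ?thesis by blast
  qed
qed (auto elim: rec_eval.cases)

definition computable :: "(nat \<Rightarrow> nat) \<Rightarrow> bool" where
  "computable f \<longleftrightarrow> (\<exists>r. \<forall>x. rec_eval r [x] (f x))"

text \<open>Recursively enumerable sets of pairs, as the domains of binary partial recursive functions.\<close>

definition re_rel :: "(nat \<times> nat) set \<Rightarrow> bool" where
  "re_rel A \<longleftrightarrow> (\<exists>r. \<forall>x y. (x, y) \<in> A \<longleftrightarrow> (\<exists>z. rec_eval r [x, y] z))"


section \<open>Equivalence relations under computable reducibility\<close>

definition sigma1_equiv :: "(nat \<times> nat) set \<Rightarrow> bool" where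
  "sigma1_equiv E \<longleftrightarrow> equiv UNIV E \<and> re_rel E"

definition reducible :: "(nat \<times> nat) set \<Rightarrow> (nat \<times> nat) set \<Rightarrow> bool" where
  "reducible A B \<longleftrightarrow> (\<exists>f. computable f \<and> (\<forall>x y. (x, y) \<in> A \<longleftrightarrow> (f x, f y) \<in> B))"

definition complete_sigma1_equiv :: "(nat \<times> nat) set \<Rightarrow> bool" where
  "complete_sigma1_equiv R \<longleftrightarrow> sigma1_equiv R \<and> (\<forall>E. sigma1_equiv E \<longrightarrow> reducible E R)"


section \<open>First order logic over the full relational signature\<close>

text \<open>
  Variables are de Bruijn indices, so formulae are taken up to renaming of bound variables, and
  the terms are just the variables. The predicate symbol of \<open>Pred p xs\<close> is the pair of \<open>p\<close> and
  \<open>length xs\<close>; thus there are countably many symbols of every arity. Equality is a logical symbol.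
\<close>

datatype fm =
    Falsum
  | Pred nat "nat list"
  | Eq nat nat
  | Imp fm fm
  | All fm

abbreviation Neg :: "fm \<Rightarrow> fm" where
  "Neg p \<equiv> Imp p Falsum"

abbreviation Conj :: "fm \<Rightarrow> fm \<Rightarrow> fm" where
  "Conj p q \<equiv> Neg (Imp p (Neg q))"

abbreviation Iff :: "fm \<Rightarrow> fm \<Rightarrow> fm" where
  "Iff p q \<equiv> Conj (Imp p q) (Imp q p)"

primrec rename :: "(nat \<Rightarrow> nat) \<Rightarrow> fm \<Rightarrow> fm" where
  "rename s Falsum = Falsum"
| "rename s (Pred p xs) = Pred p (map s xs)"
| "rename s (Eq x y) = Eq (s x) (s y)"
| "rename s (Imp p q) = Imp (rename s p) (rename s q)"
| "rename s (All p) = All (rename (case_nat 0 (\<lambda>x. Suc (s x))) p)"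

text \<open>\<open>inst x p\<close> replaces the variable \<open>0\<close> of \<open>p\<close> by \<open>x\<close> and lowers the other free variables by one.\<close>

definition inst :: "nat \<Rightarrow> fm \<Rightarrow> fm" where
  "inst x = rename (case_nat x (\<lambda>y. y))"

text \<open>
  A Hilbert calculus for classical logic with equality. In \<open>All_vacuous\<close> the renaming by \<open>Suc\<close>
  expresses that the quantified variable is not free in \<open>p\<close>.
\<close>

inductive provable :: "fm \<Rightarrow> bool" (\<open>\<turnstile> _\<close> [50] 50) where
  Imp_K: "\<turnstile> Imp p (Imp q p)"
| Imp_S: "\<turnstile> Imp (Imp p (Imp q r)) (Imp (Imp p q) (Imp p r))"
| Neg_Neg: "\<turnstile> Imp (Neg (Neg p)) p"
| All_inst: "\<turnstile> Imp (All p) (inst x p)"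
| All_Imp: "\<turnstile> Imp (All (Imp p q)) (Imp (All p) (All q))"
| All_vacuous: "\<turnstile> Imp p (All (rename Suc p))"
| Eq_refl: "\<turnstile> Eq x x"
| Eq_subst: "\<turnstile> Imp (Eq x y) (Imp (inst x p) (inst y p))"
| MP: "\<turnstile> Imp p q \<Longrightarrow> \<turnstile> p \<Longrightarrow> \<turnstile> q"
| Gen: "\<turnstile> p \<Longrightarrow> \<turnstile> All p"


section \<open>Formulae as natural numbers\<close>

primrec fm_encode :: "fm \<Rightarrow> nat" where
  "fm_encode Falsum = 0"
| "fm_encode (Pred p xs) = 4 * prod_encode (p, list_encode xs) + 1"
| "fm_encode (Eq x y) = 4 * prod_encode (x, y) + 2"
| "fm_encode (Imp p q) = 4 * prod_encode (fm_encode p, fm_encode q) + 3"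
| "fm_encode (All p) = 4 * fm_encode p + 4"

lemma inj_fm_encode: "inj fm_encode"
proof (rule injI)
  have residues: "4 * a + 1 \<noteq> 4 * b + 2" "4 * a + 1 \<noteq> 4 * b + 3" "4 * a + 1 \<noteq> 4 * b + 4"
    "4 * a + 2 \<noteq> 4 * b + 3" "4 * a + 2 \<noteq> 4 * b + 4" "4 * a + 3 \<noteq> 4 * b + 4"
    "4 * b + 2 \<noteq> 4 * a + 1" "4 * b + 3 \<noteq> 4 * a + 1" "4 * b + 4 \<noteq> 4 * a + 1"
    "4 * b + 3 \<noteq> 4 * a + 2" "4 * b + 4 \<noteq> 4 * a + 2" "4 * b + 4 \<noteq> 4 * a + 3"
    for a b :: nat
    by presburger+
  show "p = q" if "fm_encode p = fm_encode q" for p q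
    using that
  proof (induction p arbitrary: q)
    case Falsum
    then show ?case by (cases q) simp_all
  next
    case (Pred p xs)
    with residues show ?case by (cases q) (simp_all add: list_encode_eq)
  next
    case (Eq x y)
    with residues show ?case by (cases q) (simp_all add: list_encode_eq)
  next
    case (Imp p1 p2)
    with residues show ?case by (cases q) (simp_all add: list_encode_eq)
  next
    case (All p)
    with residues show ?case by (cases q) (simp_all add: list_encode_eq)
  qed
qed

lemma surj_fm_encode: "surj fm_encode"
proof -
  have "\<exists>p. fm_encode p = n" for n
  proof (induction n rule: less_induct)
    case (less n)
    show ?case
    proof (cases n)
      case 0
      then show ?thesis by (metis fm_encode.simps(1))
    next
      case (Suc m)
      define k where "k = m div 4"
      obtain a b where ab: "prod_encode (a, b) = k"
        by (metis prod_decode_inverse surj_pair)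
      then have le: "a \<le> k" "b \<le> k"
        using le_prod_encode_1 le_prod_encode_2 by blast+
      have "k < n" using Suc k_def by simp
      with le less obtain p q r where
        pqr: "fm_encode p = a" "fm_encode q = b" "fm_encode r = k"
        by (meson order.strict_trans1)
      consider "n = 4 * k + 1" | "n = 4 * k + 2" | "n = 4 * k + 3" | "n = 4 * k + 4"
        unfolding k_def Suc by linarith
      then show ?thesis
      proof cases
        case 1
        then have "fm_encode (Pred a (list_decode b)) = n" using ab by simp
        then show ?thesis ..
      next
        case 2
        then have "fm_encode (Eq a b) = n" using ab by simp
        then show ?thesis ..
      next
        case 3
        then have "fm_encode (Imp p q) = n" using ab pqr by simp
        then show ?thesis ..
      next
        case 4
        then have "fm_encode (All r) = n" using pqr by simp
        then show ?thesis ..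
      qed
    qed
  qed
  then show ?thesis by (metis surjI)
qed

lemma bij_fm_encode: "bij fm_encode"
  using inj_fm_encode surj_fm_encode by (rule bijI)

definition logical_equiv :: "(nat \<times> nat) set" where
  "logical_equiv = {(fm_encode p, fm_encode q) | p q. \<turnstile> Iff p q}"

end

theory Submission
  imports Defs Complex_Main "HOL-Library.Countable"
begin

text \<open>
  Provability is generated by finitely many rules with computable premises and conclusions, once
  the graph of the renaming operations is generated along with it; the set generated by such rules
  is the range of a computable function.

  For hardness, let \<open>r\<close> enumerate \<open>E\<close>. The computations of \<open>r\<close> are described by finitely many
  Horn clauses over a successor relation, and one more clause makes a unary predicate \<open>P\<close> closed
  under \<open>E\<close>. Let \<open>f n\<close> say that these clauses and the totality of the successor relation imply
  that \<open>P\<close> holds at the end of every successor path of length \<open>n\<close> from zero. If \<open>E\<close> relates \<open>x\<close>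
  and \<open>y\<close>, then \<open>f x\<close> yields \<open>f y\<close>: extend a path of length \<open>y\<close> until it contains all numbers
  of the computation witnessing this. Conversely, interpreting \<open>P\<close> as the \<open>E\<close>-class of \<open>x\<close> in the
  standard model makes \<open>f y\<close> true exactly for the \<open>y\<close> in that class.
\<close>

section \<open>Total computable functions of several arguments\<close>

text \<open>The arguments form one list and only lists of length \<open>k\<close> matter, so that
  composition and recursion can be stated for all arities at once.\<close>

definition total_rec :: "nat \<Rightarrow> (nat list \<Rightarrow> nat) \<Rightarrow> bool" where
  "total_rec k F \<longleftrightarrow> (\<exists>r. \<forall>xs. length xs = k \<longrightarrow> rec_eval r xs (F xs))"

lemma total_rec_cong:
  "total_rec k F \<Longrightarrow> (\<And>xs. length xs = k \<Longrightarrow> F xs = G xs) \<Longrightarrow> total_rec k G"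
  by (auto simp: total_rec_def)

lemma computable_iff_total_rec: "computable f \<longleftrightarrow> total_rec 1 (\<lambda>xs. f (xs ! 0))"
proof
  assume "computable f"
  then show "total_rec 1 (\<lambda>xs. f (xs ! 0))"
    by (fastforce simp: computable_def total_rec_def length_Suc_conv)
next
  assume "total_rec 1 (\<lambda>xs. f (xs ! 0))"
  then obtain r where r: "\<And>xs. length xs = 1 \<Longrightarrow> rec_eval r xs (f (xs ! 0))"
    by (auto simp: total_rec_def)
  have "rec_eval r [x] (f x)" for x using r[of "[x]"] by simp
  then show "computable f" by (auto simp: computable_def)
qed

lemma total_rec_nth: "i < k \<Longrightarrow> total_rec k (\<lambda>xs. xs ! i)"
  by (auto simp: total_rec_def intro: rec_eval.proj)

lemma total_rec_comp:
  assumes F: "total_rec (length Gs) F" and Gs: "\<And>G. G \<in> set Gs \<Longrightarrow> total_rec k G"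
  shows "total_rec k (\<lambda>xs. F (map (\<lambda>G. G xs) Gs))"
proof -
  obtain f where f: "\<And>xs. length xs = length Gs \<Longrightarrow> rec_eval f xs (F xs)"
    using F by (auto simp: total_rec_def)
  obtain g where g: "\<And>G xs. G \<in> set Gs \<Longrightarrow> length xs = k \<Longrightarrow> rec_eval (g G) xs (G xs)"
    using Gs unfolding total_rec_def by metis
  have "rec_eval (Comp f (map g Gs)) xs (F (map (\<lambda>G. G xs) Gs))" if "length xs = k" for xs
    by (rule rec_eval.comp[where ys = "map (\<lambda>G. G xs) Gs"])
      (use f g that in \<open>auto simp: list_all2_conv_all_nth\<close>)
  then show ?thesis by (auto simp: total_rec_def)
qed

lemma total_rec_compose:
  assumes "computable f" "total_rec k G"
  shows "total_rec k (\<lambda>xs. f (G xs))"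
  using total_rec_comp[of "[G]" "\<lambda>xs. f (xs ! 0)" k] assms
  by (simp add: computable_iff_total_rec)

lemma total_rec_Suc: "total_rec k G \<Longrightarrow> total_rec k (\<lambda>xs. Suc (G xs))"
  by (rule total_rec_compose) (auto simp: computable_def intro: rec_eval.succ)

lemma total_rec_const: "total_rec k (\<lambda>xs. c)"
proof (induction c)
  case 0
  then show ?case by (auto simp: total_rec_def intro: rec_eval.zero)
qed (rule total_rec_Suc)

lemma total_rec_rec_nat:
  assumes N: "total_rec k N" and F: "total_rec k F" and G: "total_rec (Suc (Suc k)) G"
  shows "total_rec k (\<lambda>xs. rec_nat (F xs) (\<lambda>n y. G (n # y # xs)) (N xs))"
proof -
  let ?R = "\<lambda>n xs. rec_nat (F xs) (\<lambda>n y. G (n # y # xs)) n"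
  obtain f where f: "\<And>xs. length xs = k \<Longrightarrow> rec_eval f xs (F xs)"
    using F by (auto simp: total_rec_def)
  obtain g where g: "\<And>xs. length xs = Suc (Suc k) \<Longrightarrow> rec_eval g xs (G xs)"
    using G by (auto simp: total_rec_def)
  have "rec_eval (PrimRec f g) (n # xs) (?R n xs)" if "length xs = k" for n xs
  proof (induction n)
    case 0
    then show ?case using f that by (auto intro: rec_eval.primrec_0)
  next
    case (Suc n)
    then show ?case using g[of "n # ?R n xs # xs"] that by (auto intro: rec_eval.primrec_Suc)
  qed
  then have R: "total_rec (Suc k) (\<lambda>xs. ?R (hd xs) (tl xs))"
    by (fastforce simp: total_rec_def length_Suc_conv)
  \<comment> \<open>Composing with \<open>N\<close> and the \<open>k\<close> projections substitutes
    \<open>N xs\<close> for the counter and passes the parameters through.\<close>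
  have "total_rec k (\<lambda>xs. ?R (hd (map (\<lambda>H. H xs) (N # map (\<lambda>i xs. xs ! i) [0..<k])))
      (tl (map (\<lambda>H. H xs) (N # map (\<lambda>i xs. xs ! i) [0..<k]))))"
    by (rule total_rec_comp) (use R N in \<open>auto intro: total_rec_nth\<close>)
  then show ?thesis
    by (rule total_rec_cong) (auto simp: comp_def map_nth)
qed

text \<open>The step function of a recursion receives the counter and the previous value in front of
  the parameters; this lets it ignore both.\<close>

lemma total_rec_drop2:
  assumes "total_rec k F"
  shows "total_rec (Suc (Suc k)) (\<lambda>xs. F (tl (tl xs)))"
proof -
  have "total_rec (Suc (Suc k)) (\<lambda>xs. F (map (\<lambda>G. G xs) (map (\<lambda>i xs. xs ! (i + 2)) [0..<k])))"
    by (rule total_rec_comp) (use assms in \<open>auto intro!: total_rec_nth\<close>)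
  moreover have "map (\<lambda>i. xs ! Suc (Suc i)) [0..<k] = tl (tl xs)"
    if "length xs = Suc (Suc k)" for xs :: "nat list"
    using that by (auto intro!: nth_equalityI simp: nth_tl)
  ultimately show ?thesis
    by (auto elim!: total_rec_cong simp: comp_def)
qed

text \<open>\<open>ex\<close> makes the search of \<open>Mu\<close> terminate, and below the least
  zero all values are successors, as \<open>rec_eval.mu\<close> demands.\<close>

lemma total_rec_Least:
  assumes F: "total_rec (Suc k) F"
    and ex: "\<And>xs. length xs = k \<Longrightarrow> \<exists>n. F (n # xs) = 0"
  shows "total_rec k (\<lambda>xs. LEAST n. F (n # xs) = 0)"
proof -
  obtain f where f: "\<And>xs. length xs = Suc k \<Longrightarrow> rec_eval f xs (F xs)"
    using F by (auto simp: total_rec_def)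
  have "rec_eval (Mu f) xs (LEAST n. F (n # xs) = 0)" if xs: "length xs = k" for xs
  proof (rule rec_eval.mu)
    have "F ((LEAST n. F (n # xs) = 0) # xs) = 0" using ex[OF xs] by (rule LeastI_ex)
    then show "rec_eval f ((LEAST n. F (n # xs) = 0) # xs) 0"
      using f[of "(LEAST n. F (n # xs) = 0) # xs"] xs by simp
    show "\<forall>m<LEAST n. F (n # xs) = 0. \<exists>k. rec_eval f (m # xs) (Suc k)"
    proof (intro allI impI)
      fix m assume "m < (LEAST n. F (n # xs) = 0)"
      then have "F (m # xs) \<noteq> 0" by (rule not_less_Least)
      then obtain j where "F (m # xs) = Suc j" by (cases "F (m # xs)") auto
      then show "\<exists>k. rec_eval f (m # xs) (Suc k)" using f[of "m # xs"] xs by auto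
    qed
  qed
  then show ?thesis by (auto simp: total_rec_def)
qed

section \<open>Arithmetic and case distinctions\<close>

lemma total_rec_add:
  assumes "total_rec k F" "total_rec k G"
  shows "total_rec k (\<lambda>xs. F xs + G xs)"
proof -
  have "total_rec k (\<lambda>xs. rec_nat (F xs) (\<lambda>n y. Suc ((n # y # xs) ! 1)) (G xs))"
    by (intro total_rec_rec_nat assms total_rec_Suc total_rec_nth) simp
  moreover have "rec_nat a (\<lambda>n y. Suc ((n # y # xs) ! 1)) b = a + b" for a b :: nat and xs
    by (induction b) auto
  ultimately show ?thesis by simp
qed

lemma total_rec_pred:
  assumes "total_rec k F"
  shows "total_rec k (\<lambda>xs. F xs - 1)"
proof -
  have "total_rec k (\<lambda>xs. rec_nat 0 (\<lambda>n y. (n # y # xs) ! 0) (F xs))"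
    by (intro total_rec_rec_nat assms total_rec_const total_rec_nth) simp
  moreover have "rec_nat 0 (\<lambda>n y. (n # y # xs) ! 0) b = b - 1" for b :: nat and xs
    by (cases b) auto
  ultimately show ?thesis by simp
qed

lemma total_rec_diff:
  assumes "total_rec k F" "total_rec k G"
  shows "total_rec k (\<lambda>xs. F xs - G xs)"
proof -
  have "total_rec k (\<lambda>xs. rec_nat (F xs) (\<lambda>n y. (n # y # xs) ! 1 - 1) (G xs))"
    by (intro total_rec_rec_nat assms total_rec_pred total_rec_nth) simp
  moreover have "rec_nat a (\<lambda>n y. (n # y # xs) ! 1 - 1) b = a - b" for a b :: nat and xs
    by (induction b) auto
  ultimately show ?thesis by simp
qed

text \<open>A recursion over \<open>P xs\<close> that starts from \<open>F xs\<close> and whose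
  every step discards the previous value and returns \<open>G xs\<close>.\<close>

lemma total_rec_If0:
  assumes "total_rec k P" "total_rec k F" "total_rec k G"
  shows "total_rec k (\<lambda>xs. if P xs = 0 then F xs else G xs)"
proof -
  have "total_rec k (\<lambda>xs. rec_nat (F xs) (\<lambda>n y. G (tl (tl (n # y # xs)))) (P xs))"
    by (intro total_rec_rec_nat assms total_rec_drop2)
  moreover have "rec_nat (F xs) (\<lambda>n y. G (tl (tl (n # y # xs)))) b = (if b = 0 then F xs else G xs)"
    for b xs
    by (cases b) auto
  ultimately show ?thesis by simp
qed

lemma total_rec_If_less:
  assumes "total_rec k A" "total_rec k B" "total_rec k F" "total_rec k G"
  shows "total_rec k (\<lambda>xs. if A xs < B xs then F xs else G xs)"
proof -
  have "total_rec k (\<lambda>xs. if Suc (A xs) - B xs = 0 then F xs else G xs)"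
    by (intro total_rec_If0 assms total_rec_diff total_rec_Suc)
  then show ?thesis by (simp add: Suc_le_eq)
qed

lemma total_rec_If_eq:
  assumes "total_rec k A" "total_rec k B" "total_rec k F" "total_rec k G"
  shows "total_rec k (\<lambda>xs. if A xs = B xs then F xs else G xs)"
proof -
  have "total_rec k (\<lambda>xs. if (A xs - B xs) + (B xs - A xs) = 0 then F xs else G xs)"
    by (intro total_rec_If0 assms total_rec_diff total_rec_add)
  moreover have "((a - b) + (b - a) = 0) = (a = b)" for a b :: nat by auto
  ultimately show ?thesis by simp
qed

section \<open>The pairing function and its inverse\<close>

lemma total_rec_triangle:
  assumes "total_rec k F"
  shows "total_rec k (\<lambda>xs. triangle (F xs))"
proof -
  have "total_rec k (\<lambda>xs. rec_nat 0 (\<lambda>n y. (n # y # xs) ! 1 + Suc ((n # y # xs) ! 0)) (F xs))"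
    by (intro total_rec_rec_nat assms total_rec_add total_rec_Suc total_rec_const total_rec_nth) auto
  moreover have "rec_nat 0 (\<lambda>n y. (n # y # xs) ! 1 + Suc ((n # y # xs) ! 0)) b = triangle b"
    for b :: nat and xs
    by (induction b) auto
  ultimately show ?thesis by simp
qed

lemma total_rec_prod_encode:
  "total_rec k F \<Longrightarrow> total_rec k G \<Longrightarrow> total_rec k (\<lambda>xs. prod_encode (F xs, G xs))"
  unfolding prod_encode_def by (simp add: total_rec_add total_rec_triangle)

text \<open>\<open>prod_encode (a, b)\<close> lies between \<open>triangle (a + b)\<close> and \<open>triangle (Suc (a + b))\<close>.\<close>

lemma prod_decode_via_Least:
  defines "d n \<equiv> LEAST s. Suc n - triangle (Suc s) = 0"
  shows "fst (prod_decode n) = n - triangle (d n)"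
    and "snd (prod_decode n) = d n - (n - triangle (d n))"
proof -
  obtain a b where ab: "prod_decode n = (a, b)" by fastforce
  then have n: "n = triangle (a + b) + a"
    using prod_decode_inverse[of n] by (simp add: prod_encode_def)
  have mono: "triangle i \<le> triangle j" if "i \<le> j" for i j
    using that by (induction rule: dec_induct) auto
  have "d n = a + b"
    unfolding d_def
  proof (rule Least_equality)
    show "Suc n - triangle (Suc (a + b)) = 0" by (simp add: n)
    show "a + b \<le> s" if "Suc n - triangle (Suc s) = 0" for s
    proof (rule ccontr)
      assume "\<not> a + b \<le> s"
      then have "triangle (Suc s) \<le> triangle (a + b)" by (intro mono) simp
      then show False using that n by linarith
    qed
  qed
  then show "fst (prod_decode n) = n - triangle (d n)"
    and "snd (prod_decode n) = d n - (n - triangle (d n))"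
    using ab n by auto
qed

lemma computable_prod_decode:
  "computable (\<lambda>n. fst (prod_decode n))" "computable (\<lambda>n. snd (prod_decode n))"
proof -
  let ?F = "\<lambda>ys :: nat list. Suc (ys ! 1) - triangle (Suc (ys ! 0))"
  have "total_rec 1 (\<lambda>xs. LEAST s. ?F (s # xs) = 0)"
  proof (rule total_rec_Least)
    show "total_rec (Suc 1) ?F"
      by (intro total_rec_diff total_rec_Suc total_rec_triangle total_rec_nth) auto
    \<comment> \<open>The search succeeds at \<open>s = n\<close> at the latest, since
      \<open>triangle (Suc n)\<close> is at least \<open>Suc n\<close>.\<close>
    have "n \<le> triangle n" for n by (induction n) auto
    then have "?F ((xs ! 0) # xs) = 0" for xs by (simp add: le_SucI trans_le_add1)
    then show "\<exists>s. ?F (s # xs) = 0" for xs by blast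
  qed
  then have d: "total_rec 1 (\<lambda>xs. LEAST s. Suc (xs ! 0) - triangle (Suc s) = 0)" by simp
  show "computable (\<lambda>n. fst (prod_decode n))" "computable (\<lambda>n. snd (prod_decode n))"
    unfolding computable_iff_total_rec prod_decode_via_Least
    by (intro total_rec_diff total_rec_triangle total_rec_nth d; simp)+
qed

lemmas total_rec_fst_prod_decode = total_rec_compose[OF computable_prod_decode(1)]
lemmas total_rec_snd_prod_decode = total_rec_compose[OF computable_prod_decode(2)]

lemma total_rec_mult4:
  assumes "total_rec k F"
  shows "total_rec k (\<lambda>xs. 4 * F xs)"
proof -
  have "total_rec k (\<lambda>xs. F xs + F xs + (F xs + F xs))"
    by (intro total_rec_add assms)
  then show ?thesis by (rule total_rec_cong) simp
qed

lemmas total_rec_intros =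
  total_rec_const total_rec_Suc total_rec_add total_rec_diff total_rec_mult4 total_rec_If_less
  total_rec_If_eq total_rec_prod_encode total_rec_fst_prod_decode total_rec_snd_prod_decode

section \<open>Inductively generated sets of numbers\<close>

text \<open>Every rule has two premises and one numerical parameter; the axiom \<open>0\<close> pads
  rules with fewer premises.\<close>

inductive derivable :: "((nat \<Rightarrow> nat) \<times> (nat \<Rightarrow> nat) \<times> (nat \<Rightarrow> nat)) set \<Rightarrow> nat \<Rightarrow> bool"
  for R where
  zero: "derivable R 0"
| rule: "(a, b, c) \<in> R \<Longrightarrow> derivable R (a u) \<Longrightarrow> derivable R (b u) \<Longrightarrow> derivable R (c u)"

fun rule_instances ::
  "(nat \<Rightarrow> nat) \<times> (nat \<Rightarrow> nat) \<times> (nat \<Rightarrow> nat) \<Rightarrow> (nat \<times> nat \<times> nat) set" where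
  "rule_instances (a, b, c) = range (\<lambda>u. (a u, b u, c u))"

text \<open>Only the set of rule instances matters, and the instance \<open>(0, 0, 0)\<close>
  derives nothing beyond the axiom.\<close>

lemma derivable_mono:
  assumes "\<Union> (rule_instances ` R) \<subseteq> insert (0, 0, 0) (\<Union> (rule_instances ` R'))"
    and "derivable R x"
  shows "derivable R' x"
  using assms(2)
proof induction
  case (rule a b c u)
  then have "(a u, b u, c u) \<in> insert (0, 0, 0) (\<Union> (rule_instances ` R'))"
    using assms(1) by fastforce
  then consider "c u = 0"
    | a' b' c' v where "(a', b', c') \<in> R'" "a u = a' v" "b u = b' v" "c u = c' v"
    by auto
  then show ?case
  proof cases
    case 2
    then show ?thesis using rule.IH derivable.rule[of a' b' c' R' v] by simp
  qed (simp add: derivable.zero)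
qed (rule derivable.zero)

text \<open>The parameter is read as a pair whose first component selects the rule and whose second
  is passed on to it. The instance \<open>(0, 0, 0)\<close> is there because even the empty set of
  rules has to become a triple of total functions.\<close>

lemma merge_rules:
  assumes "finite R"
    and "\<And>a b c. (a, b, c) \<in> R \<Longrightarrow> computable a \<and> computable b \<and> computable c"
  shows "\<exists>a b c. computable a \<and> computable b \<and> computable c \<and>
    rule_instances (a, b, c) = insert (0, 0, 0) (\<Union> (rule_instances ` R))"
  using assms
proof (induction R rule: finite_induct)
  case empty
  have "computable (\<lambda>u. 0)"
    unfolding computable_iff_total_rec by (rule total_rec_const)
  then show ?case by (intro exI[of _ "\<lambda>u. 0"]) auto
next
  case (insert r R)
  obtain a b c where abc: "computable a" "computable b" "computable c"
    and R: "rule_instances (a, b, c) = insert (0, 0, 0) (\<Union> (rule_instances ` R))"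
  proof -
    have "\<exists>a b c. computable a \<and> computable b \<and> computable c \<and>
        rule_instances (a, b, c) = insert (0, 0, 0) (\<Union> (rule_instances ` R))"
      by (rule insert.IH) (use insert.prems in blast)
    then show ?thesis using that by blast
  qed
  obtain a' b' c' where r: "r = (a', b', c')" by (cases r)
  have r_comp: "computable a'" "computable b'" "computable c'"
    using insert.prems r by auto
  let ?g = "\<lambda>f' f u. if fst (prod_decode u) = 0 then f' (snd (prod_decode u))
    else f (snd (prod_decode u))"
  have g: "computable (?g f' f)" if "computable f'" "computable f"
    for f' f :: "nat \<Rightarrow> nat"
    unfolding computable_iff_total_rec
    by (intro total_rec_intros total_rec_compose[OF that(1)] total_rec_compose[OF that(2)]
        total_rec_nth) auto
  have "rule_instances (?g a' a, ?g b' b, ?g c' c) =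
      rule_instances (a', b', c') \<union> rule_instances (a, b, c)" (is "?L = ?M")
  proof
    show "?L \<subseteq> ?M" by (auto split: if_splits)
    have "(a' v, b' v, c' v) \<in> ?L" for v
      by simp (rule image_eqI[where x = "prod_encode (0, v)"]; simp)
    moreover have "(a v, b v, c v) \<in> ?L" for v
      by simp (rule image_eqI[where x = "prod_encode (1, v)"]; simp)
    ultimately show "?M \<subseteq> ?L" by auto
  qed
  also have "\<dots> = insert (0, 0, 0) (\<Union> (rule_instances ` insert r R))"
    unfolding R r by auto
  finally show ?case using g[OF r_comp(1) abc(1)] g[OF r_comp(2) abc(2)] g[OF r_comp(3) abc(3)]
    by blast
qed

text \<open>
  Stage \<open>prod_encode (i, prod_encode (j, u))\<close> of the enumeration applies instance \<open>u\<close> of the rule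
  to the results of the stages \<open>i\<close> and \<open>j\<close>, which the pairing function makes available since
  it dominates its arguments. The state is the list of all earlier results.
\<close>

lemma derivable_enumeration:
  assumes "finite R"
    and "\<And>a b c. (a, b, c) \<in> R \<Longrightarrow> computable a \<and> computable b \<and> computable c"
  shows "\<exists>e. computable e \<and> (\<forall>x. derivable R x \<longleftrightarrow> (\<exists>n. e n = x))"
proof -
  obtain a b c where abc: "computable a" "computable b" "computable c"
    and inst: "rule_instances (a, b, c) = insert (0, 0, 0) (\<Union> (rule_instances ` R))"
    using merge_rules[OF assms] by blast
  have R: "derivable R x \<longleftrightarrow> derivable {(a, b, c)} x" for x
    using derivable_mono[of R "{(a, b, c)}"] derivable_mono[of "{(a, b, c)}" R] inst by auto
  let ?fst = "\<lambda>x. fst (prod_decode x)" and ?snd = "\<lambda>x. snd (prod_decode x)"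
  \<comment> \<open>A history is \<open>0\<close> or the successor of a pair of the latest result
    and the earlier history. As \<open>0\<close> decodes to \<open>(0, 0)\<close>, the empty history
    has head and tail \<open>0\<close>.\<close>
  define hdc where "hdc h = ?fst (h - 1)" for h
  define tlc where "tlc h = ?snd (h - 1)" for h
  define dropc where "dropc h n = rec_nat h (\<lambda>_. tlc) n" for h n
  \<comment> \<open>Dropping \<open>n - i\<close> entries from \<open>hist n\<close> leaves
    \<open>hist i\<close>, whose head is result \<open>i\<close>. A stage whose premises do not
    match yields the axiom \<open>0\<close>.\<close>
  define step where "step n h =
    (if hdc (dropc h (n - ?fst n)) = a (?snd (?snd n)) then
       if hdc (dropc h (n - ?fst (?snd n))) = b (?snd (?snd n)) then c (?snd (?snd n)) else 0
     else 0)" for n h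
  define hist where "hist n = rec_nat 0 (\<lambda>n h. Suc (prod_encode (step n h, h))) n" for n
  have hist_simps [simp]: "hist 0 = 0" "hist (Suc n) = Suc (prod_encode (step n (hist n), hist n))" for n
    by (simp_all add: hist_def)
  have dec0: "prod_decode 0 = (0, 0)"
    using prod_encode_inverse[of "(0, 0)"] by (simp add: prod_encode_def)
  have tl_hist: "tlc (hist n) = hist (n - 1)" for n
    by (cases n) (simp_all add: tlc_def dec0)
  have drop_hist: "dropc (hist n) i = hist (n - i)" for n i
    by (induction i) (simp_all add: dropc_def tl_hist)
  have hd_hist [simp]: "hdc 0 = 0" "hdc (Suc (prod_encode (x, h))) = x" for x h
    by (simp_all add: hdc_def dec0)
  have tr_hdc: "total_rec k (\<lambda>xs. hdc (F xs))" if "total_rec k F" for k F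
    unfolding hdc_def by (intro total_rec_intros that)
  have tr_dropc: "total_rec k (\<lambda>xs. dropc (F xs) (G xs))" if "total_rec k F" "total_rec k G" for k F G
  proof -
    have "total_rec k (\<lambda>xs. rec_nat (F xs) (\<lambda>n y. ?snd ((n # y # xs) ! 1 - 1)) (G xs))"
      by (intro total_rec_rec_nat that total_rec_intros total_rec_nth) simp
    then show ?thesis unfolding dropc_def by (simp add: tlc_def[abs_def])
  qed
  have tr_hist: "computable (\<lambda>n. hdc (hist n))"
  proof -
    let ?G = "\<lambda>ys. Suc (prod_encode (step (ys ! 0) (ys ! 1), ys ! 1))"
    have "total_rec (Suc (Suc 1)) ?G"
      unfolding step_def
      by (intro total_rec_intros tr_hdc tr_dropc total_rec_compose[OF abc(1)]
          total_rec_compose[OF abc(2)] total_rec_compose[OF abc(3)] total_rec_nth) auto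
    then have "total_rec 1 (\<lambda>xs. hdc (rec_nat 0 (\<lambda>n h. ?G (n # h # xs)) (xs ! 0)))"
      by (intro tr_hdc total_rec_rec_nat total_rec_const total_rec_nth) auto
    then show ?thesis
      unfolding computable_iff_total_rec hist_def by simp
  qed
  have sound: "derivable {(a, b, c)} (hdc (hist n))" for n
  proof (induction n rule: less_induct)
    case (less n)
    show ?case
    proof (cases n)
      case 0
      then show ?thesis by (simp add: derivable.zero)
    next
      case (Suc m)
      let ?x = "hdc (hist (m - (m - ?fst m)))" and ?y = "hdc (hist (m - (m - ?fst (?snd m))))"
      have "derivable {(a, b, c)} ?x" "derivable {(a, b, c)} ?y"
        using less Suc by simp_all
      then have "derivable {(a, b, c)} (c u)" if "?x = a u" "?y = b u" for u
        using that derivable.rule[of a b c "{(a, b, c)}" u] by simp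
      then show ?thesis
        using Suc derivable.zero by (simp add: step_def drop_hist)
    qed
  qed
  have complete: "\<exists>n. hdc (hist n) = x" if "derivable {(a, b, c)} x" for x
    using that
  proof induction
    case zero
    then show ?case by (intro exI[of _ 0]) simp
  next
    case (rule a' b' c' u)
    then obtain i j where ij: "hdc (hist i) = a u" "hdc (hist j) = b u" and c': "c' = c" by auto
    define n where "n = prod_encode (i, prod_encode (j, u))"
    have "i \<le> n" "j \<le> n"
      unfolding n_def using le_prod_encode_1 le_prod_encode_2 order_trans by blast+
    then have "hdc (hist (Suc n)) = c u"
      using ij by (simp add: step_def drop_hist) (simp add: n_def)
    then show ?case using c' by blast
  qed
  show ?thesis
    using tr_hist sound complete unfolding R by blast
qed

section \<open>Derivations from hypotheses\<close>

text \<open>Without generalisation, so that the deduction theorem needs no side condition.\<close>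

inductive entails :: "fm set \<Rightarrow> fm \<Rightarrow> bool" (infix \<open>\<tturnstile>\<close> 50) for \<Gamma> where
  hyp: "p \<in> \<Gamma> \<Longrightarrow> \<Gamma> \<tturnstile> p"
| prov: "\<turnstile> p \<Longrightarrow> \<Gamma> \<tturnstile> p"
| mp: "\<Gamma> \<tturnstile> Imp p q \<Longrightarrow> \<Gamma> \<tturnstile> p \<Longrightarrow> \<Gamma> \<tturnstile> q"

lemma entails_trans: "\<Delta> \<tturnstile> p \<Longrightarrow> (\<And>q. q \<in> \<Delta> \<Longrightarrow> \<Gamma> \<tturnstile> q) \<Longrightarrow> \<Gamma> \<tturnstile> p"
  by (induction rule: entails.induct) (auto intro: entails.intros)

lemma entails_mono: "\<Delta> \<tturnstile> p \<Longrightarrow> \<Delta> \<subseteq> \<Gamma> \<Longrightarrow> \<Gamma> \<tturnstile> p"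
  by (rule entails_trans) (auto intro: entails.hyp)

lemma entails_empty_iff: "{} \<tturnstile> p \<longleftrightarrow> \<turnstile> p"
proof
  show "{} \<tturnstile> p \<Longrightarrow> \<turnstile> p" by (induction rule: entails.induct) (auto intro: provable.MP)
qed (rule entails.prov)

text \<open>The deduction theorem with its converse: \<open>Imp_K\<close> and \<open>Imp_S\<close>
  carry the extra premise through the derivation.\<close>

lemma entails_Imp_iff: "\<Gamma> \<tturnstile> Imp p q \<longleftrightarrow> insert p \<Gamma> \<tturnstile> q"
proof
  assume "\<Gamma> \<tturnstile> Imp p q"
  then have "insert p \<Gamma> \<tturnstile> Imp p q" by (rule entails_mono) auto
  then show "insert p \<Gamma> \<tturnstile> q" by (rule entails.mp) (simp add: entails.hyp)
next
  assume "insert p \<Gamma> \<tturnstile> q"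
  then show "\<Gamma> \<tturnstile> Imp p q"
  proof induction
    case (hyp q)
    have "\<Gamma> \<tturnstile> Imp p p"
      by (meson Imp_K Imp_S entails.mp entails.prov)
    moreover have "\<Gamma> \<tturnstile> Imp p q" if "q \<in> \<Gamma>"
      using that by (meson Imp_K entails.hyp entails.mp entails.prov)
    ultimately show ?case using hyp by auto
  next
    case (prov q)
    then show ?case by (meson Imp_K entails.mp entails.prov)
  next
    case (mp q r)
    then show ?case by (meson Imp_S entails.mp entails.prov)
  qed
qed

lemma entails_foldr_Imp_iff: "\<Gamma> \<tturnstile> foldr Imp ps q \<longleftrightarrow> set ps \<union> \<Gamma> \<tturnstile> q"
  by (induction ps arbitrary: \<Gamma>) (simp_all add: entails_Imp_iff)

lemma entails_ccontr: "insert (Neg p) \<Gamma> \<tturnstile> Falsum \<Longrightarrow> \<Gamma> \<tturnstile> p"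
  by (meson Neg_Neg entails.mp entails.prov entails_Imp_iff)

lemma entails_Conj_iff: "\<Gamma> \<tturnstile> Conj p q \<longleftrightarrow> \<Gamma> \<tturnstile> p \<and> \<Gamma> \<tturnstile> q"
proof safe
  assume conj: "\<Gamma> \<tturnstile> Conj p q"
  \<comment> \<open>\<open>Conj p q\<close> is itself a negation, so either conjunct follows by
    contradiction once its negation implies \<open>Imp p (Neg q)\<close>.\<close>
  have neg: "\<Gamma> \<tturnstile> r" if "insert (Neg r) \<Gamma> \<tturnstile> Imp p (Neg q)" for r
  proof (rule entails_ccontr)
    have "insert (Neg r) \<Gamma> \<tturnstile> Conj p q" using conj by (rule entails_mono) auto
    then show "insert (Neg r) \<Gamma> \<tturnstile> Falsum" using that by (rule entails.mp)
  qed
  show "\<Gamma> \<tturnstile> p"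
  proof (rule neg)
    have "insert p (insert (Neg p) \<Gamma>) \<tturnstile> Falsum"
      by (rule entails.mp[of _ p]) (auto intro: entails.hyp)
    then show "insert (Neg p) \<Gamma> \<tturnstile> Imp p (Neg q)"
      unfolding entails_Imp_iff by (rule entails_mono) auto
  qed
  show "\<Gamma> \<tturnstile> q"
    by (rule neg) (auto simp: entails_Imp_iff[of _ p] intro: entails.hyp)
next
  assume "\<Gamma> \<tturnstile> p" "\<Gamma> \<tturnstile> q"
  then have "insert (Imp p (Neg q)) \<Gamma> \<tturnstile> p" "insert (Imp p (Neg q)) \<Gamma> \<tturnstile> q"
    by (auto elim: entails_mono)
  then have "insert (Imp p (Neg q)) \<Gamma> \<tturnstile> Falsum"
    by (meson entails.hyp entails.mp insertI1)
  then show "\<Gamma> \<tturnstile> Conj p q" by (simp add: entails_Imp_iff[of _ "Imp p (Neg q)"])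
qed

lemma provable_Iff_iff: "\<turnstile> Iff p q \<longleftrightarrow> {p} \<tturnstile> q \<and> {q} \<tturnstile> p"
  by (simp only: entails_empty_iff[symmetric] entails_Conj_iff entails_Imp_iff[of _ p q]
      entails_Imp_iff[of _ q p])

text \<open>The shifted hypotheses leave variable \<open>0\<close> fresh. \<open>All\<close> is put
  in front of every formula of the derivation and distributed by \<open>All_Imp\<close>; the
  quantified hypotheses then follow from the original ones by \<open>All_vacuous\<close>.\<close>

lemma entails_AllI:
  assumes "rename Suc ` \<Gamma> \<tturnstile> p"
  shows "\<Gamma> \<tturnstile> All p"
proof -
  have "All ` \<Delta> \<tturnstile> All p" if "\<Delta> \<tturnstile> p" for \<Delta>
    using that
  proof induction
    case (prov p)
    then show ?case by (intro entails.prov provable.Gen)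
  next
    case (mp p q)
    then show ?case by (meson All_Imp entails.mp entails.prov)
  qed (auto intro: entails.hyp)
  from this[OF assms] show ?thesis
  proof (rule entails_trans)
    fix q assume "q \<in> All ` rename Suc ` \<Gamma>"
    then show "\<Gamma> \<tturnstile> q"
      by (auto intro: entails.mp[OF entails.prov[OF All_vacuous]] entails.hyp)
  qed
qed

lemma entails_inst: "\<Gamma> \<tturnstile> All p \<Longrightarrow> \<Gamma> \<tturnstile> inst x p"
  by (meson All_inst entails.mp entails.prov)

lemma rename_rename: "rename s (rename t p) = rename (s \<circ> t) p"
proof (induction p arbitrary: s t)
  case (All p)
  then show ?case by (auto simp: comp_def split: nat.split intro!: arg_cong2[of _ _ _ _ rename])
qed auto

lemma rename_id: "rename (\<lambda>x. x) p = p"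
proof (induction p)
  case (All p)
  have "case_nat 0 Suc = (\<lambda>x. x)" by (auto split: nat.split)
  with All show ?case by simp
qed auto

text \<open>Simultaneous instantiation of \<open>k\<close> quantifiers: \<open>s\<close> is
  arbitrary on the bound variables and lowers the others by \<open>k\<close>, the number of binders
  removed.\<close>

lemma entails_inst_all:
  assumes "\<Gamma> \<tturnstile> (All ^^ k) p" and "\<And>i. s (i + k) = i"
  shows "\<Gamma> \<tturnstile> rename s p"
  using assms
proof (induction k arbitrary: p s)
  case 0
  then have "s = (\<lambda>x. x)" by auto
  with 0 show ?case by (simp add: rename_id)
next
  case (Suc k)
  \<comment> \<open>The outer \<open>k\<close> quantifiers go first, with the innermost one counted
    as part of the body; that one then takes the value \<open>s 0\<close>.\<close>
  have "\<Gamma> \<tturnstile> rename (s \<circ> Suc) (All p)"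
    using Suc.IH[of "All p" "s \<circ> Suc"] Suc.prems by (simp add: funpow_swap1)
  then have "\<Gamma> \<tturnstile> inst (s 0) (rename (case_nat 0 (\<lambda>x. Suc (s (Suc x)))) p)"
    using entails_inst by simp
  moreover have "case_nat (s 0) (\<lambda>y. y) \<circ> case_nat 0 (\<lambda>x. Suc (s (Suc x))) = s"
    by (auto split: nat.split)
  ultimately show ?case by (simp add: inst_def rename_rename)
qed


section \<open>Soundness\<close>

primrec sem :: "(nat \<Rightarrow> 'a list \<Rightarrow> bool) \<Rightarrow> (nat \<Rightarrow> 'a) \<Rightarrow> fm \<Rightarrow> bool" where
  "sem I e Falsum \<longleftrightarrow> False"
| "sem I e (Pred p xs) \<longleftrightarrow> I p (map e xs)"
| "sem I e (Eq x y) \<longleftrightarrow> e x = e y"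
| "sem I e (Imp p q) \<longleftrightarrow> (sem I e p \<longrightarrow> sem I e q)"
| "sem I e (All p) \<longleftrightarrow> (\<forall>a. sem I (case_nat a e) p)"

lemma sem_rename: "sem I e (rename s p) \<longleftrightarrow> sem I (e \<circ> s) p"
proof (induction p arbitrary: e s)
  case (All p)
  have "case_nat a e \<circ> case_nat 0 (\<lambda>x. Suc (s x)) = case_nat a (e \<circ> s)" for a
    by (auto split: nat.split)
  then show ?case by (simp only: rename.simps sem.simps All.IH)
qed auto

lemma sem_inst: "sem I e (inst x p) \<longleftrightarrow> sem I (case_nat (e x) e) p"
proof -
  have "e \<circ> case_nat x (\<lambda>y. y) = case_nat (e x) e" by (auto split: nat.split)
  then show ?thesis by (simp add: inst_def sem_rename)
qed

theorem soundness: "\<turnstile> p \<Longrightarrow> sem I e p"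
proof (induction arbitrary: e rule: provable.induct)
  case (All_vacuous p)
  have "case_nat a e \<circ> Suc = e" for a by auto
  then show ?case by (simp add: sem_rename)
qed (auto simp: sem_inst)

lemma sem_foldr_Imp: "sem I e (foldr Imp ps q) \<longleftrightarrow> ((\<forall>p \<in> set ps. sem I e p) \<longrightarrow> sem I e q)"
  by (induction ps) auto

section \<open>Horn clauses\<close>

type_synonym atom = "nat \<times> nat list"
type_synonym clause = "atom list \<times> atom"

text \<open>One more than the sum of all variables exceeds each of them, so that
  \<open>clause_fm\<close> is a sentence.\<close>

definition clause_bound :: "clause \<Rightarrow> nat" where
  "clause_bound c = Suc (sum_list (concat (map snd (snd c # fst c))))"

definition clause_matrix :: "clause \<Rightarrow> fm" where
  "clause_matrix c = foldr Imp (map (\<lambda>(p, xs). Pred p xs) (fst c)) (Pred (fst (snd c)) (snd (snd c)))"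

definition clause_fm :: "clause \<Rightarrow> fm" where
  "clause_fm c = (All ^^ clause_bound c) (clause_matrix c)"

text \<open>
  Used both for truth in the standard model and for derivability, where the numbers \<open>s i\<close>
  stand for variables.
\<close>

definition closed_under :: "(nat \<Rightarrow> nat list \<Rightarrow> bool) \<Rightarrow> clause \<Rightarrow> bool" where
  "closed_under H c \<longleftrightarrow> (\<forall>s. (\<forall>(p, xs) \<in> set (fst c). H p (map s xs)) \<longrightarrow>
    H (fst (snd c)) (map s (snd (snd c))))"

lemma sem_clause_fm:
  assumes "closed_under I c"
  shows "sem I e (clause_fm c)"
proof -
  have "sem I e ((All ^^ k) p)" if "\<And>e. sem I e p" for k p e
    using that by (induction k arbitrary: e) auto
  moreover have "sem I e (clause_matrix c)" for e
    using assms by (fastforce simp: clause_matrix_def closed_under_def sem_foldr_Imp)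
  ultimately show ?thesis by (simp add: clause_fm_def)
qed

lemma less_clause_bound:
  assumes "(p, xs) = snd c \<or> (p, xs) \<in> set (fst c)" "i \<in> set xs"
  shows "i < clause_bound c"
proof -
  have "i \<in> set (concat (map snd (snd c # fst c)))"
    using assms by (cases "snd c") force+
  then show ?thesis
    unfolding clause_bound_def by (simp add: member_le_sum_list less_Suc_eq_le del: concat.simps list.map)
qed

lemma rename_clause_matrix:
  "rename s (clause_matrix c) =
    foldr Imp (map (\<lambda>(p, xs). Pred p (map s xs)) (fst c)) (Pred (fst (snd c)) (map s (snd (snd c))))"
proof -
  have "rename s (foldr Imp (map (\<lambda>(p, xs). Pred p xs) as) q) =
      foldr Imp (map (\<lambda>(p, xs). Pred p (map s xs)) as) (rename s q)" for as q
    by (induction as) auto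
  then show ?thesis by (simp add: clause_matrix_def)
qed

lemma rename_clause_matrix_cong:
  assumes "\<And>i. i < clause_bound c \<Longrightarrow> s i = t i"
  shows "rename s (clause_matrix c) = rename t (clause_matrix c)"
proof -
  have "map s xs = map t xs" if "(p, xs) = snd c \<or> (p, xs) \<in> set (fst c)" for p xs
    using assms less_clause_bound[OF that] by auto
  then have "map s (snd (snd c)) = map t (snd (snd c))"
    and "\<And>p xs. (p, xs) \<in> set (fst c) \<Longrightarrow> map s xs = map t xs"
    by (metis prod.collapse)+
  then show ?thesis
    unfolding rename_clause_matrix
    by (intro arg_cong2[of _ _ _ _ "foldr Imp"] map_cong refl) auto
qed

lemma rename_clause_fm: "rename s (clause_fm c) = clause_fm c"
proof -
  \<comment> \<open>Below \<open>k\<close> binders every renaming fixes the first \<open>k\<close>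
    variables, and the matrix contains no others.\<close>
  have "\<exists>t. rename s ((All ^^ k) p) = (All ^^ k) (rename t p) \<and> (\<forall>i<k. t i = i)" for k p
  proof (induction k arbitrary: p)
    case (Suc k)
    obtain t where t: "rename s ((All ^^ k) (All p)) = (All ^^ k) (rename t (All p))" "\<forall>i<k. t i = i"
      using Suc by blast
    then show ?case
      by (intro exI[of _ "case_nat 0 (\<lambda>x. Suc (t x))"]) (auto simp: funpow_swap1 split: nat.split)
  qed auto
  then obtain t where t: "rename s (clause_fm c) = (All ^^ clause_bound c) (rename t (clause_matrix c))"
    "\<forall>i<clause_bound c. t i = i"
    unfolding clause_fm_def by blast
  then have "rename t (clause_matrix c) = rename (\<lambda>x. x) (clause_matrix c)"
    by (intro rename_clause_matrix_cong) auto
  with t show ?thesis by (simp add: rename_id clause_fm_def)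
qed

lemma closed_under_entails:
  assumes "\<Gamma> \<tturnstile> clause_fm c"
  shows "closed_under (\<lambda>p xs. \<Gamma> \<tturnstile> Pred p xs) c"
  unfolding closed_under_def
proof (intro allI impI)
  fix s assume body: "\<forall>(p, xs) \<in> set (fst c). \<Gamma> \<tturnstile> Pred p (map s xs)"
  \<comment> \<open>\<open>t\<close> agrees with \<open>s\<close> on the variables of the clause and
    has the form that \<open>entails_inst_all\<close> requires above them.\<close>
  define t where "t i = (if i < clause_bound c then s i else i - clause_bound c)" for i
  have "\<Gamma> \<tturnstile> rename t (clause_matrix c)"
    using assms unfolding clause_fm_def by (rule entails_inst_all) (simp add: t_def)
  also have "rename t (clause_matrix c) = rename s (clause_matrix c)"
    by (rule rename_clause_matrix_cong) (simp add: t_def)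
  finally have "set (map (\<lambda>(p, xs). Pred p (map s xs)) (fst c)) \<union> \<Gamma> \<tturnstile>
      Pred (fst (snd c)) (map s (snd (snd c)))"
    unfolding rename_clause_matrix entails_foldr_Imp_iff .
  then show "\<Gamma> \<tturnstile> Pred (fst (snd c)) (map s (snd (snd c)))"
    by (rule entails_trans) (use body in \<open>auto intro: entails.hyp\<close>)
qed

section \<open>Logical equivalence is recursively enumerable\<close>

text \<open>
  The renamings occurring in the axioms, under \<open>d\<close> binders: \<open>shift_inst d 0\<close> for the renaming
  by \<open>Suc\<close> and \<open>shift_inst d (Suc x)\<close> for the instantiation with \<open>x\<close>.
\<close>

definition shift_inst :: "nat \<Rightarrow> nat \<Rightarrow> nat \<Rightarrow> nat" where
  "shift_inst d t y =
    (if y < d then y else if t = 0 then Suc y else if y = d then (t - 1) + d else y - 1)"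

text \<open>The reason for the parameter \<open>d\<close>: the family is closed under passing a
  binder, so two numbers describe every renaming that arises.\<close>

lemma shift_inst_lift: "case_nat 0 (\<lambda>x. Suc (shift_inst d t x)) = shift_inst (Suc d) t"
  by (auto simp: shift_inst_def fun_eq_iff split: nat.split)

lemma shift_inst_0: "shift_inst 0 0 = Suc"
  by (auto simp: shift_inst_def)

lemma inst_shift_inst: "inst x p = rename (shift_inst 0 (Suc x)) p"
  by (auto simp: shift_inst_def fun_eq_iff inst_def split: nat.split intro!: arg_cong2[of _ _ _ _ rename])

section \<open>Codes of formulae and judgements\<close>

definition fm_decode :: "nat \<Rightarrow> fm" where
  "fm_decode = inv fm_encode"

lemma fm_decode_encode [simp]: "fm_decode (fm_encode p) = p"
  by (simp add: fm_decode_def inj_fm_encode)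

lemma fm_encode_decode [simp]: "fm_encode (fm_decode n) = n"
  by (simp add: fm_decode_def surj_f_inv_f surj_fm_encode)

lemma fm_decode_eqI: "fm_encode p = n \<Longrightarrow> fm_decode n = p"
  by auto

text \<open>The values of \<open>fm_encode\<close> written with \<open>Suc\<close>, a form to which
  \<open>total_rec_intros\<close> applies directly.\<close>

abbreviation enc_Pred :: "nat \<Rightarrow> nat \<Rightarrow> nat" where
  "enc_Pred p xs \<equiv> Suc (4 * prod_encode (p, xs))"

abbreviation enc_Eq :: "nat \<Rightarrow> nat \<Rightarrow> nat" where
  "enc_Eq x y \<equiv> Suc (Suc (4 * prod_encode (x, y)))"

abbreviation enc_Imp :: "nat \<Rightarrow> nat \<Rightarrow> nat" where
  "enc_Imp p q \<equiv> Suc (Suc (Suc (4 * prod_encode (p, q))))"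

abbreviation enc_All :: "nat \<Rightarrow> nat" where
  "enc_All p \<equiv> Suc (Suc (Suc (Suc (4 * p))))"

lemma fm_decode_simps [simp]:
  "fm_decode 0 = Falsum"
  "fm_decode (enc_Pred p xs) = Pred p (list_decode xs)"
  "fm_decode (enc_Eq x y) = Eq x y"
  "fm_decode (enc_Imp m n) = Imp (fm_decode m) (fm_decode n)"
  "fm_decode (enc_All m) = All (fm_decode m)"
  by (rule fm_decode_eqI; simp)+

abbreviation tuple5 :: "nat \<Rightarrow> nat \<Rightarrow> nat \<Rightarrow> nat \<Rightarrow> nat \<Rightarrow> nat" where
  "tuple5 j d t x y \<equiv> prod_encode (j, prod_encode (d, prod_encode (t, prod_encode (x, y))))"

abbreviation "list_judg \<equiv> tuple5 1"
abbreviation "fm_judg \<equiv> tuple5 2"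
abbreviation "prov_judg p \<equiv> prod_encode (3, p)"

text \<open>Numbers whose tag is not \<open>1\<close>, \<open>2\<close> or \<open>3\<close> count as
  valid, among them the axiom \<open>0\<close>, which is \<open>prod_encode (0, 0)\<close>.\<close>

definition judg_valid :: "nat \<Rightarrow> bool" where
  "judg_valid n = (case prod_decode n of (j, m) \<Rightarrow>
    if j = 3 then \<turnstile> fm_decode m
    else case prod_decode m of (d, m') \<Rightarrow> case prod_decode m' of (t, m'') \<Rightarrow>
      case prod_decode m'' of (x, y) \<Rightarrow>
        if j = 1 then list_decode y = map (shift_inst d t) (list_decode x)
        else j = 2 \<longrightarrow> fm_decode y = rename (shift_inst d t) (fm_decode x))"

lemma judg_valid_simps [simp]:
  "judg_valid (list_judg d t x y) \<longleftrightarrow> list_decode y = map (shift_inst d t) (list_decode x)"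
  "judg_valid (fm_judg d t x y) \<longleftrightarrow> fm_decode y = rename (shift_inst d t) (fm_decode x)"
  "judg_valid (prov_judg p) \<longleftrightarrow> \<turnstile> fm_decode p"
  by (simp_all add: judg_valid_def)

text \<open>The single parameter of a rule carries several numbers as pairs nested to the right. The
  final \<open>0\<close> in \<open>args\<close> makes the sixth number a first component like the
  rest.\<close>

definition arg :: "nat \<Rightarrow> nat \<Rightarrow> nat" where
  "arg i u = fst (prod_decode (((\<lambda>v. snd (prod_decode v)) ^^ i) u))"

abbreviation args :: "nat \<Rightarrow> nat \<Rightarrow> nat \<Rightarrow> nat \<Rightarrow> nat \<Rightarrow> nat \<Rightarrow> nat" where
  "args x0 x1 x2 x3 x4 x5 \<equiv>
    prod_encode (x0, tuple5 x1 x2 x3 x4 (prod_encode (x5, 0)))"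

lemma arg_args:
  "arg 0 (args x0 x1 x2 x3 x4 x5) = x0" "arg 1 (args x0 x1 x2 x3 x4 x5) = x1"
  "arg 2 (args x0 x1 x2 x3 x4 x5) = x2" "arg 3 (args x0 x1 x2 x3 x4 x5) = x3"
  "arg 4 (args x0 x1 x2 x3 x4 x5) = x4" "arg 5 (args x0 x1 x2 x3 x4 x5) = x5"
  by (simp_all add: arg_def eval_nat_numeral)

lemma total_rec_arg:
  assumes "total_rec k F"
  shows "total_rec k (\<lambda>xs. arg i (F xs))"
proof -
  have "total_rec k (\<lambda>xs. ((\<lambda>v. snd (prod_decode v)) ^^ i) (F xs))"
    by (induction i) (auto intro: total_rec_snd_prod_decode assms)
  then show ?thesis unfolding arg_def by (rule total_rec_fst_prod_decode)
qed

text \<open>A premise \<open>\<lambda>u. 0\<close> stands for no premise, as \<open>0\<close> is always derivable.\<close>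

definition judg_rules :: "((nat \<Rightarrow> nat) \<times> (nat \<Rightarrow> nat) \<times> (nat \<Rightarrow> nat)) set" where
  "judg_rules = {
    (\<lambda>u. 0, \<lambda>u. 0, \<lambda>u. list_judg (arg 0 u) (arg 1 u) 0 0),
    (\<lambda>u. list_judg (arg 0 u) (arg 1 u) (arg 2 u) (arg 3 u), \<lambda>u. 0,
      \<lambda>u. list_judg (arg 0 u) (arg 1 u) (Suc (prod_encode (arg 4 u, arg 2 u)))
        (Suc (prod_encode (shift_inst (arg 0 u) (arg 1 u) (arg 4 u), arg 3 u)))),
    (\<lambda>u. 0, \<lambda>u. 0, \<lambda>u. fm_judg (arg 0 u) (arg 1 u) 0 0),
    (\<lambda>u. list_judg (arg 0 u) (arg 1 u) (arg 2 u) (arg 3 u), \<lambda>u. 0,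
      \<lambda>u. fm_judg (arg 0 u) (arg 1 u) (enc_Pred (arg 4 u) (arg 2 u)) (enc_Pred (arg 4 u) (arg 3 u))),
    (\<lambda>u. 0, \<lambda>u. 0, \<lambda>u. fm_judg (arg 0 u) (arg 1 u) (enc_Eq (arg 2 u) (arg 3 u))
      (enc_Eq (shift_inst (arg 0 u) (arg 1 u) (arg 2 u)) (shift_inst (arg 0 u) (arg 1 u) (arg 3 u)))),
    (\<lambda>u. fm_judg (arg 0 u) (arg 1 u) (arg 2 u) (arg 3 u),
      \<lambda>u. fm_judg (arg 0 u) (arg 1 u) (arg 4 u) (arg 5 u),
      \<lambda>u. fm_judg (arg 0 u) (arg 1 u) (enc_Imp (arg 2 u) (arg 4 u)) (enc_Imp (arg 3 u) (arg 5 u))),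
    (\<lambda>u. fm_judg (Suc (arg 0 u)) (arg 1 u) (arg 2 u) (arg 3 u), \<lambda>u. 0,
      \<lambda>u. fm_judg (arg 0 u) (arg 1 u) (enc_All (arg 2 u)) (enc_All (arg 3 u))),
    (\<lambda>u. 0, \<lambda>u. 0, \<lambda>u. prov_judg (enc_Imp (arg 0 u) (enc_Imp (arg 1 u) (arg 0 u)))),
    (\<lambda>u. 0, \<lambda>u. 0, \<lambda>u. prov_judg (enc_Imp (enc_Imp (arg 0 u) (enc_Imp (arg 1 u) (arg 2 u)))
      (enc_Imp (enc_Imp (arg 0 u) (arg 1 u)) (enc_Imp (arg 0 u) (arg 2 u))))),
    (\<lambda>u. 0, \<lambda>u. 0, \<lambda>u. prov_judg (enc_Imp (enc_Imp (enc_Imp (arg 0 u) 0) 0) (arg 0 u))),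
    (\<lambda>u. fm_judg 0 (Suc (arg 0 u)) (arg 1 u) (arg 2 u), \<lambda>u. 0,
      \<lambda>u. prov_judg (enc_Imp (enc_All (arg 1 u)) (arg 2 u))),
    (\<lambda>u. 0, \<lambda>u. 0, \<lambda>u. prov_judg (enc_Imp (enc_All (enc_Imp (arg 0 u) (arg 1 u)))
      (enc_Imp (enc_All (arg 0 u)) (enc_All (arg 1 u))))),
    (\<lambda>u. fm_judg 0 0 (arg 0 u) (arg 1 u), \<lambda>u. 0,
      \<lambda>u. prov_judg (enc_Imp (arg 0 u) (enc_All (arg 1 u)))),
    (\<lambda>u. 0, \<lambda>u. 0, \<lambda>u. prov_judg (enc_Eq (arg 0 u) (arg 0 u))),
    (\<lambda>u. fm_judg 0 (Suc (arg 0 u)) (arg 2 u) (arg 3 u),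
      \<lambda>u. fm_judg 0 (Suc (arg 1 u)) (arg 2 u) (arg 4 u),
      \<lambda>u. prov_judg (enc_Imp (enc_Eq (arg 0 u) (arg 1 u)) (enc_Imp (arg 3 u) (arg 4 u)))),
    (\<lambda>u. prov_judg (enc_Imp (arg 0 u) (arg 1 u)), \<lambda>u. prov_judg (arg 0 u),
      \<lambda>u. prov_judg (arg 1 u)),
    (\<lambda>u. prov_judg (arg 0 u), \<lambda>u. 0, \<lambda>u. prov_judg (enc_All (arg 0 u)))}"

lemma total_rec_shift_inst:
  "total_rec k D \<Longrightarrow> total_rec k T \<Longrightarrow> total_rec k Y \<Longrightarrow>
    total_rec k (\<lambda>xs. shift_inst (D xs) (T xs) (Y xs))"
  unfolding shift_inst_def by (intro total_rec_intros)

lemma judg_rules_computable: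
  "\<forall>(a, b, c) \<in> judg_rules. computable a \<and> computable b \<and> computable c"
  unfolding judg_rules_def computable_iff_total_rec ball_simps prod.case
  by (intro conjI TrueI total_rec_intros total_rec_shift_inst total_rec_arg total_rec_nth zero_less_one)

lemma judg_rules_valid:
  "\<forall>(a, b, c) \<in> judg_rules. \<forall>u. judg_valid (a u) \<longrightarrow> judg_valid (b u) \<longrightarrow> judg_valid (c u)"
  unfolding judg_rules_def ball_simps prod.case
  by (intro conjI TrueI allI impI; simp only: judg_valid_simps fm_decode_simps)
    (simp_all add: shift_inst_lift Imp_K Imp_S Neg_Neg All_Imp Eq_refl Gen
      All_inst[unfolded inst_shift_inst] All_vacuous[folded shift_inst_0] Eq_subst[unfolded inst_shift_inst]
      MP[of "fm_decode (arg 0 u)" "fm_decode (arg (Suc 0) u)" for u])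

definition judg :: "nat \<Rightarrow> bool" where
  "judg = derivable judg_rules"

lemma judg_0: "judg 0"
  by (simp add: judg_def derivable.zero)

lemma judg_valid_0: "judg_valid 0"
proof -
  have "0 = prod_encode (0, 0)" by (simp add: prod_encode_def)
  then have "prod_decode 0 = (0, 0)" by (metis prod_encode_inverse)
  then show ?thesis by (simp add: judg_valid_def)
qed

lemma judg_imp_judg_valid: "judg n \<Longrightarrow> judg_valid n"
  unfolding judg_def
  by (induction rule: derivable.induct) (use judg_rules_valid in \<open>auto simp: judg_valid_0\<close>)

lemma judg_closed:
  "\<forall>(a, b, c) \<in> judg_rules. judg (a (args x0 x1 x2 x3 x4 x5)) \<longrightarrow>
    judg (b (args x0 x1 x2 x3 x4 x5)) \<longrightarrow> judg (c (args x0 x1 x2 x3 x4 x5))"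
  unfolding judg_def by (auto intro: derivable.rule)

lemmas judg_intros = judg_closed[unfolded judg_rules_def ball_simps prod.case arg_args]

lemma judg_list: "judg (list_judg d t (list_encode xs) (list_encode (map (shift_inst d t) xs)))"
proof (induction xs)
  case Nil
  then show ?case using judg_intros judg_0 by simp
next
  case (Cons x xs)
  then show ?case
    using judg_intros[of d t "list_encode xs" "list_encode (map (shift_inst d t) xs)" x] judg_0 by simp
qed

lemma fm_encode_Suc:
  "fm_encode Falsum = 0"
  "fm_encode (Pred p xs) = enc_Pred p (list_encode xs)"
  "fm_encode (Eq x y) = enc_Eq x y"
  "fm_encode (Imp q r) = enc_Imp (fm_encode q) (fm_encode r)"
  "fm_encode (All q) = enc_All (fm_encode q)"
  by simp_all

text \<open>The induction generalises over \<open>d\<close> because the rule for \<open>All\<close>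
  has its premise at \<open>Suc d\<close>.\<close>

lemma judg_fm: "judg (fm_judg d t (fm_encode p) (fm_encode (rename (shift_inst d t) p)))"
proof (induction p arbitrary: d)
  case Falsum
  then show ?case using judg_intros judg_0 by (simp only: rename.simps fm_encode_Suc)
next
  case (Pred p xs)
  then show ?case
    using judg_intros[of d t _ _ p] judg_0 judg_list by (simp only: rename.simps fm_encode_Suc)
next
  case (Eq x y)
  then show ?case
    using judg_intros[of d t x y] judg_0 by (simp only: rename.simps fm_encode_Suc)
next
  case (Imp p q)
  then show ?case
    using judg_intros[of d t] by (simp only: rename.simps fm_encode_Suc)
next
  case (All p)
  then show ?case
    using judg_intros[of d t] judg_0 by (simp only: rename.simps fm_encode_Suc shift_inst_lift)
qed

lemma judg_provable: "\<turnstile> p \<Longrightarrow> judg (prov_judg (fm_encode p))"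
proof (induction rule: provable.induct)
  case (Imp_K p q)
  then show ?case using judg_intros judg_0 by (simp only: fm_encode_Suc)
next
  case (Imp_S p q r)
  then show ?case using judg_intros judg_0 by (simp only: fm_encode_Suc)
next
  case (Neg_Neg p)
  then show ?case using judg_intros judg_0 by (simp only: fm_encode_Suc)
next
  case (All_inst p x)
  then show ?case
    using judg_intros[of x] judg_0 judg_fm[of 0] by (simp only: inst_shift_inst fm_encode_Suc)
next
  case (All_Imp p q)
  then show ?case using judg_intros judg_0 by (simp only: fm_encode_Suc)
next
  case (All_vacuous p)
  then show ?case using judg_intros judg_0 judg_fm[of 0 0] by (simp only: shift_inst_0 fm_encode_Suc)
next
  case (Eq_refl x)
  then show ?case using judg_intros judg_0 by (simp only: fm_encode_Suc)
next
  case (Eq_subst x y p)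
  then show ?case
    using judg_intros[of x y "fm_encode p"] judg_fm[of 0] by (simp only: inst_shift_inst fm_encode_Suc)
next
  case (MP p q)
  then show ?case using judg_intros by (simp only: fm_encode_Suc)
next
  case (Gen p)
  then show ?case using judg_intros judg_0 by (simp only: fm_encode_Suc)
qed

lemma judg_provable_iff: "judg (prov_judg (fm_encode p)) \<longleftrightarrow> \<turnstile> p"
  using judg_provable judg_imp_judg_valid[of "prov_judg (fm_encode p)"] by auto

text \<open>\<open>Mu\<close> searches an enumeration of the derivable judgements for the one
  stating the equivalence; the domain of this search is the relation.\<close>

lemma re_rel_logical_equiv: "re_rel logical_equiv"
proof -
  \<comment> \<open>The code of \<open>Iff\<close> with its abbreviations expanded; \<open>0\<close>
    is the code of \<open>Falsum\<close>.\<close>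
  let ?iff = "\<lambda>x y. enc_Imp (enc_Imp (enc_Imp x y) (enc_Imp (enc_Imp y x) 0)) 0"
  obtain e where e: "computable e" "\<And>x. judg x \<longleftrightarrow> (\<exists>n. e n = x)"
  proof -
    have "finite judg_rules" by (simp add: judg_rules_def)
    then show ?thesis
      using that derivable_enumeration[of judg_rules] judg_rules_computable unfolding judg_def by blast
  qed
  let ?F = "\<lambda>ys. if e (ys ! 0) = prov_judg (?iff (ys ! 1) (ys ! 2)) then 0 else 1"
  have "total_rec 3 ?F"
    by (intro total_rec_intros total_rec_compose[OF e(1)] total_rec_nth) auto
  then obtain r where "\<And>ys. length ys = 3 \<Longrightarrow> rec_eval r ys (?F ys)"
    by (auto simp: total_rec_def)
  from this[of "[n, x, y]" for n x y] have r: "rec_eval r [n, x, y] (?F [n, x, y])" for n x y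
    by simp
  have "(\<exists>z. rec_eval (Mu r) [x, y] z) \<longleftrightarrow> (\<exists>n. e n = prov_judg (?iff x y))" for x y
  proof
    assume "\<exists>z. rec_eval (Mu r) [x, y] z"
    then obtain n where "rec_eval r [n, x, y] 0"
      by (auto elim: rec_eval.cases)
    from rec_eval_deterministic[OF r this] show "\<exists>n. e n = prov_judg (?iff x y)"
      by (intro exI[of _ n]) (simp split: if_splits)
  next
    assume ex: "\<exists>n. e n = prov_judg (?iff x y)"
    let ?n = "LEAST n. e n = prov_judg (?iff x y)"
    have "rec_eval (Mu r) [x, y] ?n"
    proof (rule rec_eval.mu)
      show "rec_eval r (?n # [x, y]) 0"
        using r[of ?n x y] LeastI_ex[OF ex] by simp
      show "\<forall>m<?n. \<exists>k. rec_eval r (m # [x, y]) (Suc k)"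
      proof (intro allI impI exI)
        fix m assume "m < ?n"
        then have "e m \<noteq> prov_judg (?iff x y)" by (rule not_less_Least)
        then show "rec_eval r (m # [x, y]) (Suc 0)" using r[of m x y] by simp
      qed
    qed
    then show "\<exists>z. rec_eval (Mu r) [x, y] z" ..
  qed
  also have "(\<exists>n. e n = prov_judg (?iff x y)) \<longleftrightarrow> (x, y) \<in> logical_equiv" for x y
  proof -
    have "(x, y) \<in> logical_equiv \<longleftrightarrow> \<turnstile> Iff (fm_decode x) (fm_decode y)"
      by (auto simp: logical_equiv_def) (metis fm_encode_decode)
    also have "\<dots> \<longleftrightarrow> judg (prov_judg (?iff x y))"
      unfolding judg_provable_iff[symmetric] fm_encode_Suc fm_encode_decode ..
    finally show ?thesis using e(2) by simp
  qed
  finally show ?thesis unfolding re_rel_def by blast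
qed

lemma sigma1_equiv_logical_equiv: "sigma1_equiv logical_equiv"
proof -
  have "equiv UNIV logical_equiv"
  proof (rule equivI)
    have "(fm_encode p, fm_encode p) \<in> logical_equiv" for p
      by (auto simp: logical_equiv_def provable_Iff_iff intro: entails.hyp)
    then have "(x, x) \<in> logical_equiv" for x by (metis fm_encode_decode)
    then show "refl logical_equiv" by (rule refl_onI)
    show "sym logical_equiv"
      by (auto simp: sym_def logical_equiv_def provable_Iff_iff)
    show "trans logical_equiv"
      unfolding trans_def logical_equiv_def
      by (auto simp: provable_Iff_iff inj_eq[OF inj_fm_encode]; blast intro: entails_trans)
  qed auto
  then show ?thesis by (simp add: sigma1_equiv_def re_rel_logical_equiv)
qed

section \<open>Horn programs for recursive functions\<close>

text \<open>\<open>to_nat\<close> supplies distinct predicate symbols for distinct terms; for a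
  fixed \<open>r\<close> they enter the reduction as constants.\<close>

instance recf :: countable
  by countable_datatype

abbreviation (input) "p_zero \<equiv> 0 :: nat"
abbreviation (input) "p_suc \<equiv> 1 :: nat"
abbreviation (input) "p_class \<equiv> 2 :: nat"

text \<open>
  \<open>p_eval f (y # xs)\<close> says that \<open>f\<close> has the value \<open>y\<close> at \<open>xs\<close>, and \<open>p_pos f (n # xs)\<close>
  that \<open>f\<close> has positive values at \<open>m # xs\<close> for all \<open>m < n\<close>.
\<close>

definition p_eval :: "recf \<Rightarrow> nat" where
  "p_eval f = 2 * to_nat f + 3"

definition p_pos :: "recf \<Rightarrow> nat" where
  "p_pos f = 2 * to_nat f + 4"

text \<open>\<open>k\<close> is the number of arguments. In \<open>Comp\<close> the variables are
  the arguments, then the intermediate values, then the result; in \<open>PrimRec\<close> and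
  \<open>Mu\<close> the variables below \<open>4\<close> are auxiliary and the parameters start at
  \<open>4\<close>. One number can serve at several arities, since a symbol includes its
  arity.\<close>

fun program :: "recf \<Rightarrow> nat \<Rightarrow> clause list" where
  "program Zero k = [([(p_zero, [0])], (p_eval Zero, 0 # [1..<k + 1]))]"
| "program Succ k = [([(p_suc, [1, 0])], (p_eval Succ, [0, 1]))]"
| "program (Proj i) k = (if i < k then [([], (p_eval (Proj i), i # [0..<k]))] else [])"
| "program (Comp f gs) k =
    (map (\<lambda>i. (p_eval (gs ! i), (k + i) # [0..<k])) [0..<length gs]
        @ [(p_eval f, (k + length gs) # [k..<k + length gs])],
      (p_eval (Comp f gs), (k + length gs) # [0..<k]))
    # program f (length gs) @ concat (map (\<lambda>g. program g k) gs)"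
| "program (PrimRec f g) k =
    [([(p_zero, [0]), (p_eval f, 1 # [4..<k + 3])], (p_eval (PrimRec f g), 1 # 0 # [4..<k + 3])),
     ([(p_eval (PrimRec f g), 1 # 0 # [4..<k + 3]), (p_eval g, 2 # 0 # 1 # [4..<k + 3]), (p_suc, [0, 3])],
      (p_eval (PrimRec f g), 2 # 3 # [4..<k + 3]))]
    @ program f (k - 1) @ program g (k + 1)"
| "program (Mu f) k =
    [([(p_zero, [0])], (p_pos f, 0 # [4..<k + 4])),
     ([(p_pos f, 0 # [4..<k + 4]), (p_eval f, 1 # 0 # [4..<k + 4]), (p_suc, [2, 1]), (p_suc, [0, 3])],
      (p_pos f, 3 # [4..<k + 4])),
     ([(p_pos f, 0 # [4..<k + 4]), (p_eval f, 1 # 0 # [4..<k + 4]), (p_zero, [1])],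
      (p_eval (Mu f), 0 # [4..<k + 4]))]
    @ program f (k + 1)"

lemma closed_underD:
  "closed_under H (B, (p, zs)) \<Longrightarrow> \<forall>(q, ys) \<in> set B. H q (map s ys) \<Longrightarrow> H p (map s zs)"
  by (auto simp: closed_under_def)

lemma assignment4:
  obtains s :: "nat \<Rightarrow> nat" where "s 0 = a" "s 1 = b" "s 2 = c" "s 3 = d"
    "map s [4..<length xs + 4] = xs"
proof (rule that)
  let ?s = "\<lambda>i. ([a, b, c, d] @ xs) ! i"
  show "?s 0 = a" "?s 1 = b" "?s 2 = c" "?s 3 = d" by simp_all
  show "map ?s [4..<length xs + 4] = xs" by (rule nth_equalityI) (simp_all add: nth_append)
qed

text \<open>\<open>H\<close> is kept abstract because it will be derivability from all sufficiently
  long successor paths. The induction follows the computation.\<close>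

lemma program_complete:
  assumes zero: "H p_zero [0]" and suc: "\<And>n. H p_suc [n, Suc n]"
    and "rec_eval f xs y" and "\<forall>c \<in> set (program f (length xs)). closed_under H c"
  shows "H (p_eval f) (y # xs)"
  using assms(3,4)
proof (induction rule: rec_eval.induct)
  case (zero xs)
  let ?s = "\<lambda>i. (0 # xs) ! i"
  have xs: "map ?s [1..<length xs + 1] = xs" by (rule nth_equalityI) (simp_all del: upt_Suc)
  have "closed_under H ([(p_zero, [0])], (p_eval Zero, 0 # [1..<length xs + 1]))"
    using zero by simp
  then have "H (p_eval Zero) (map ?s (0 # [1..<length xs + 1]))"
    by (rule closed_underD) (simp add: assms(1))
  then show ?case by (simp only: list.map xs) simp
next
  case (succ x)
  then have "closed_under H ([(p_suc, [1, 0])], (p_eval Succ, [0, 1]))" by simp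
  then have "H (p_eval Succ) (map (\<lambda>i. [Suc x, x] ! i) [0, 1])"
    by (rule closed_underD) (use suc in simp)
  then show ?case by simp
next
  case (proj i xs)
  then have "closed_under H ([], (p_eval (Proj i), i # [0..<length xs]))" by simp
  then have "H (p_eval (Proj i)) (map (\<lambda>i. xs ! i) (i # [0..<length xs]))"
    by (rule closed_underD) simp
  then show ?case by (simp add: map_nth)
next
  case (comp xs gs ys f z)
  have len: "length gs = length ys" using comp.IH(1) by (simp add: list_all2_lengthD)
  define s where "s i = (xs @ ys @ [z]) ! i" for i
  have xs: "map s [0..<length xs] = xs"
    by (rule nth_equalityI) (auto simp: nth_append s_def)
  have ys: "map s [length xs..<length xs + length ys] = ys"
    by (rule nth_equalityI) (auto simp: nth_append s_def)
  have s: "s (length xs + length ys) = z" "i < length ys \<Longrightarrow> s (length xs + i) = ys ! i" for i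
    by (simp_all add: s_def nth_append)
  have gs: "H (p_eval (gs ! i)) (ys ! i # xs)" if "i < length ys" for i
  proof -
    have "gs ! i \<in> set gs" using that len by simp
    then have "\<forall>c \<in> set (program (gs ! i) (length xs)). closed_under H c"
      using comp.prems by auto
    then show ?thesis
      using comp.IH(1) that len by (auto simp: list_all2_conv_all_nth)
  qed
  have f: "H (p_eval f) (z # ys)"
    using comp.IH(2) comp.prems len by auto
  have "closed_under H
    (map (\<lambda>i. (p_eval (gs ! i), (length xs + i) # [0..<length xs])) [0..<length ys]
        @ [(p_eval f, (length xs + length ys) # [length xs..<length xs + length ys])],
      (p_eval (Comp f gs), (length xs + length ys) # [0..<length xs]))"
    using comp.prems len by simp
  then have "H (p_eval (Comp f gs)) (map s ((length xs + length ys) # [0..<length xs]))"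
    by (rule closed_underD) (auto simp: xs ys s gs f)
  then show ?case by (simp add: xs s)
next
  case (primrec_0 f xs y g)
  have f: "H (p_eval f) (y # xs)"
    using primrec_0 by auto
  obtain s :: "nat \<Rightarrow> nat" where s: "s 0 = 0" "s 1 = y" "s 2 = 0" "s 3 = 0"
    "map s [4..<length xs + 4] = xs"
    by (rule assignment4)
  have "closed_under H ([(p_zero, [0]), (p_eval f, 1 # [4..<length xs + 4])],
      (p_eval (PrimRec f g), 1 # 0 # [4..<length xs + 4]))"
    using primrec_0.prems by (simp add: add.commute)
  then have "H (p_eval (PrimRec f g)) (map s (1 # 0 # [4..<length xs + 4]))"
    by (rule closed_underD) (use f assms(1) in \<open>simp add: s[simplified]\<close>)
  then show ?case by (simp only: list.map s)
next
  case (primrec_Suc f g n xs y z)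
  have IH: "H (p_eval (PrimRec f g)) (y # n # xs)" "H (p_eval g) (z # n # y # xs)"
    using primrec_Suc.IH primrec_Suc.prems by auto
  obtain s :: "nat \<Rightarrow> nat" where s: "s 0 = n" "s 1 = y" "s 2 = z" "s 3 = Suc n"
    "map s [4..<length xs + 4] = xs"
    by (rule assignment4)
  have "closed_under H
     ([(p_eval (PrimRec f g), 1 # 0 # [4..<length xs + 4]),
       (p_eval g, 2 # 0 # 1 # [4..<length xs + 4]), (p_suc, [0, 3])],
      (p_eval (PrimRec f g), 2 # 3 # [4..<length xs + 4]))"
    using primrec_Suc.prems by (simp add: add.commute)
  then have "H (p_eval (PrimRec f g)) (map s (2 # 3 # [4..<length xs + 4]))"
    by (rule closed_underD) (use IH suc in \<open>simp add: s[simplified]\<close>)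
  then show ?case by (simp only: list.map s)
next
  case (mu f n xs)
  have prog: "\<forall>c \<in> set (program f (length (m # xs))). closed_under H c" for m
    using mu.prems by auto
  \<comment> \<open>Positivity is climbed from \<open>0\<close> up to \<open>n\<close>; a
    predecessor \<open>k\<close> of the value of \<open>f\<close> witnesses each step.\<close>
  have pos: "H (p_pos f) (m # xs)" if "m \<le> n" for m
    using that
  proof (induction m)
    case 0
    obtain s :: "nat \<Rightarrow> nat" where s: "s 0 = 0" "s 1 = 0" "s 2 = 0" "s 3 = 0"
      "map s [4..<length xs + 4] = xs"
      by (rule assignment4)
    have "closed_under H ([(p_zero, [0])], (p_pos f, 0 # [4..<length xs + 4]))"
      using mu.prems by simp
    then have "H (p_pos f) (map s (0 # [4..<length xs + 4]))"
      by (rule closed_underD) (use assms(1) in \<open>simp add: s[simplified]\<close>)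
    then show ?case by (simp only: list.map s)
  next
    case (Suc m)
    then obtain k where k: "H (p_eval f) (Suc k # m # xs)"
      using mu.IH(2) prog[of m] Suc_le_lessD by blast
    obtain s :: "nat \<Rightarrow> nat" where s: "s 0 = m" "s 1 = Suc k" "s 2 = k" "s 3 = Suc m"
      "map s [4..<length xs + 4] = xs"
      by (rule assignment4)
    have "closed_under H ([(p_pos f, 0 # [4..<length xs + 4]), (p_eval f, 1 # 0 # [4..<length xs + 4]),
        (p_suc, [2, 1]), (p_suc, [0, 3])], (p_pos f, 3 # [4..<length xs + 4]))"
      using mu.prems by simp
    then have "H (p_pos f) (map s (3 # [4..<length xs + 4]))"
      by (rule closed_underD) (use Suc k suc in \<open>simp add: s[simplified]\<close>)
    then show ?case by (simp only: list.map s)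
  qed
  have f: "H (p_eval f) (0 # n # xs)"
    using mu.IH(1) prog[of n] by auto
  obtain s :: "nat \<Rightarrow> nat" where s: "s 0 = n" "s 1 = 0" "s 2 = 0" "s 3 = 0"
    "map s [4..<length xs + 4] = xs"
    by (rule assignment4)
  have "closed_under H ([(p_pos f, 0 # [4..<length xs + 4]), (p_eval f, 1 # 0 # [4..<length xs + 4]),
      (p_zero, [1])], (p_eval (Mu f), 0 # [4..<length xs + 4]))"
    using mu.prems by simp
  then have "H (p_eval (Mu f)) (map s (0 # [4..<length xs + 4]))"
    by (rule closed_underD) (use pos f assms(1) in \<open>simp add: s[simplified]\<close>)
  then show ?case by (simp only: list.map s)
qed

section \<open>The standard model\<close>

text \<open>\<open>(p - 3) div 2\<close> recovers the code of the term from both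
  \<open>p_eval\<close> and \<open>p_pos\<close>; these are told apart by parity,
  \<open>p_eval\<close> being odd.\<close>

definition std_model :: "nat set \<Rightarrow> nat \<Rightarrow> nat list \<Rightarrow> bool" where
  "std_model X p xs \<longleftrightarrow>
    (if p = p_zero then xs = [0]
     else if p = p_suc then \<exists>n. xs = [n, Suc n]
     else if p = p_class then \<exists>n \<in> X. xs = [n]
     else case xs of [] \<Rightarrow> False
       | y # ys \<Rightarrow> let f = from_nat ((p - 3) div 2) in
           if odd p then rec_eval f ys y else \<forall>m<y. \<exists>k. rec_eval f (m # ys) (Suc k))"

lemma std_model_simps [simp]:
  "std_model X p_zero xs \<longleftrightarrow> xs = [0]"
  "std_model X p_suc xs \<longleftrightarrow> (\<exists>n. xs = [n, Suc n])"
  "std_model X (Suc 0) xs \<longleftrightarrow> (\<exists>n. xs = [n, Suc n])"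
  "std_model X p_class xs \<longleftrightarrow> (\<exists>n \<in> X. xs = [n])"
  "std_model X (p_eval f) (y # ys) \<longleftrightarrow> rec_eval f ys y"
  "std_model X (p_pos f) (y # ys) \<longleftrightarrow> (\<forall>m<y. \<exists>k. rec_eval f (m # ys) (Suc k))"
  by (simp_all add: std_model_def p_eval_def p_pos_def)

text \<open>The clauses mirror the rules of \<open>rec_eval\<close> and never mention
  \<open>p_class\<close>, so \<open>X\<close> is arbitrary.\<close>

lemma program_sound: "c \<in> set (program f k) \<Longrightarrow> closed_under (std_model X) c"
proof (induction f k rule: program.induct)
  case (4 f gs k)
  from "4.prems" consider
      "c = (map (\<lambda>i. (p_eval (gs ! i), (k + i) # [0..<k])) [0..<length gs]
        @ [(p_eval f, (k + length gs) # [k..<k + length gs])],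
        (p_eval (Comp f gs), (k + length gs) # [0..<k]))"
    | "c \<in> set (program f (length gs))" | g where "g \<in> set gs" "c \<in> set (program g k)"
    by auto
  then show ?case
  proof cases
    case 1
    have "rec_eval (Comp f gs) (map s [0..<k]) (s (k + length gs))"
      if "\<forall>i<length gs. rec_eval (gs ! i) (map s [0..<k]) (s (k + i))"
        and "rec_eval f (map s [k..<k + length gs]) (s (k + length gs))" for s
      by (rule rec_eval.comp[OF _ that(2)]) (use that(1) in \<open>simp add: list_all2_conv_all_nth\<close>)
    then show ?thesis unfolding 1 closed_under_def by auto
  qed (use "4.IH" in auto)
next
  case (5 f g k)
  then show ?case
    by (auto simp: closed_under_def intro: rec_eval.intros)
next
  case (6 f k)
  let ?xs = "[4..<k + 4]"
  from "6.prems" consider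
      "c = ([(p_zero, [0])], (p_pos f, 0 # ?xs))"
    | "c = ([(p_pos f, 0 # ?xs), (p_eval f, 1 # 0 # ?xs), (p_suc, [2, 1]), (p_suc, [0, 3])],
        (p_pos f, 3 # ?xs))"
    | "c = ([(p_pos f, 0 # ?xs), (p_eval f, 1 # 0 # ?xs), (p_zero, [1])], (p_eval (Mu f), 0 # ?xs))"
    | "c \<in> set (program f (k + 1))"
    by auto
  then show ?case
  proof cases
    case 2
    have "\<exists>j. rec_eval f (m # map s ?xs) (Suc j)"
      if "\<forall>m<s 0. \<exists>j. rec_eval f (m # map s ?xs) (Suc j)"
        "rec_eval f (s 0 # map s ?xs) (Suc (s 2))" "m < Suc (s 0)" for s m
      using that less_Suc_eq by blast
    then show ?thesis unfolding 2 closed_under_def by auto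
  next
    case 3
    have "rec_eval (Mu f) (map s ?xs) (s 0)"
      if "\<forall>m<s 0. \<exists>j. rec_eval f (m # map s ?xs) (Suc j)" "rec_eval f (s 0 # map s ?xs) 0" for s
      using that by (intro rec_eval.mu)
    then show ?thesis unfolding 3 closed_under_def by auto
  qed (use "6.IH" in \<open>auto simp: closed_under_def\<close>)
next
  case (3 i k)
  have "rec_eval (Proj i) (map s [0..<k]) (s i)" if "i < k" for s
    using rec_eval.proj[of i "map s [0..<k]"] that by simp
  with 3 show ?case by (auto simp: closed_under_def split: if_splits)
qed (auto simp: closed_under_def intro: rec_eval.intros)

section \<open>The reduction\<close>

text \<open>
  \<open>path n q\<close>: every successor path of length \<open>n\<close> from the variable \<open>0\<close> leads to a point
  satisfying \<open>q\<close>, where \<open>q\<close> has at most the variable \<open>0\<close> free.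
\<close>

primrec path :: "nat \<Rightarrow> fm \<Rightarrow> fm" where
  "path 0 q = q"
| "path (Suc n) q = All (Imp (Pred p_suc [1, 0]) (path n q))"

text \<open>Paths replace numerals. Being universal, the formula is proved by assuming a path and
  used by supplying one.\<close>

definition in_class :: "nat \<Rightarrow> fm" where
  "in_class n = All (Imp (Pred p_zero [0]) (path n (Pred p_class [0])))"

definition suc_total :: fm where
  "suc_total = All (Neg (All (Neg (Pred p_suc [1, 0]))))"

text \<open>The clause for \<open>p_class\<close> propagates membership from \<open>x\<close> to
  \<open>y\<close> when \<open>r\<close> halts on \<open>[x, y]\<close>; variable \<open>2\<close>
  is the value of \<open>r\<close>.\<close>

definition axioms_for :: "recf \<Rightarrow> fm list" where
  "axioms_for r = suc_total # map clause_fm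
    (([(p_eval r, [2, 0, 1]), (p_class, [0])], (p_class, [1])) # program r 2)"

definition reduction :: "recf \<Rightarrow> nat \<Rightarrow> fm" where
  "reduction r n = foldr Imp (axioms_for r) (in_class n)"

section \<open>The reduction in the standard model\<close>

lemma sem_path:
  "sem (std_model X) e (path n (Pred p_class [0])) \<longleftrightarrow> e 0 + n \<in> X"
  by (induction n arbitrary: e) auto

lemma sem_in_class: "sem (std_model X) e (in_class n) \<longleftrightarrow> n \<in> X"
  by (simp add: in_class_def sem_path)

lemma sem_axioms:
  assumes "\<And>x y z. rec_eval r [x, y] z \<Longrightarrow> x \<in> X \<Longrightarrow> y \<in> X" and "p \<in> set (axioms_for r)"
  shows "sem (std_model X) e p"
proof -
  have "closed_under (std_model X) ([(p_eval r, [2, 0, 1]), (p_class, [0])], (p_class, [1]))"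
    using assms(1) by (auto simp: closed_under_def)
  then show ?thesis
    using assms(2) program_sound by (auto simp: axioms_for_def suc_total_def intro: sem_clause_fm)
qed

text \<open>If \<open>X\<close> is closed under the enumerated relation, all axioms are true, so
  \<open>reduction r n\<close> is true exactly when \<open>n\<close> is in \<open>X\<close>.\<close>

lemma reduction_sound:
  assumes "\<turnstile> Iff (reduction r x) (reduction r y)"
    and "\<And>x y z. rec_eval r [x, y] z \<Longrightarrow> x \<in> X \<Longrightarrow> y \<in> X"
  shows "x \<in> X \<longleftrightarrow> y \<in> X"
proof -
  have "sem (std_model X) (\<lambda>_. 0) (reduction r n) \<longleftrightarrow> n \<in> X" for n
    using sem_axioms[OF assms(2)] by (auto simp: reduction_def sem_foldr_Imp sem_in_class)
  then show ?thesis
    using soundness[OF assms(1), of "std_model X" "\<lambda>_. 0"] by auto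
qed

section \<open>Derivations along a successor path\<close>

lemma rename_in_class: "rename s (in_class n) = in_class n"
proof -
  have "rename s (path n (Pred p [0])) = path n (Pred p [0])" if "s 0 = 0" for s p
    using that by (induction n arbitrary: s) auto
  then show ?thesis by (simp add: in_class_def)
qed

lemma rename_axioms: "p \<in> set (axioms_for r) \<Longrightarrow> rename s p = p"
  by (auto simp: axioms_for_def suc_total_def rename_clause_fm)

text \<open>
  The hypotheses \<open>points n\<close> say that the variables \<open>n, \<dots>, 0\<close> stand for the numbers
  \<open>0, \<dots>, n\<close>; the reversal makes \<open>points (Suc n)\<close> an extension of \<open>points n\<close> under a binder.
\<close>

primrec points :: "nat \<Rightarrow> fm set" where
  "points 0 = {Pred p_zero [0]}"
| "points (Suc n) = insert (Pred p_suc [1, 0]) (rename Suc ` points n)"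

lemma points_zero: "Pred p_zero [n] \<in> points n"
  by (induction n) force+

lemma points_suc: "i < n \<Longrightarrow> Pred p_suc [n - i, n - Suc i] \<in> points n"
proof (induction n)
  case (Suc n)
  show ?case
  proof (cases "i = n")
    case False
    with Suc have "Pred p_suc [n - i, n - Suc i] \<in> points n" by simp
    then have "rename Suc (Pred p_suc [n - i, n - Suc i]) \<in> points (Suc n)" by (simp del: rename.simps)
    moreover have "Suc (n - i) = Suc n - i" "Suc (n - Suc i) = Suc n - Suc i"
      using Suc.prems False by auto
    ultimately show ?thesis by simp
  qed simp
qed simp

text \<open>The last point exists by \<open>suc_total\<close>, and the shifted \<open>q\<close> does
  not mention it. The existential is a negated universal, hence the argument by
  contradiction.\<close>

lemma drop_point:
  assumes closed: "\<And>p. p \<in> \<Gamma> \<Longrightarrow> rename Suc p = p" and tot: "suc_total \<in> \<Gamma>"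
    and q: "\<Gamma> \<union> points (Suc n) \<tturnstile> rename Suc q"
  shows "\<Gamma> \<union> points n \<tturnstile> q"
proof (rule entails_ccontr)
  let ?\<Delta> = "insert (Neg q) (\<Gamma> \<union> points n)"
  have "insert (Pred p_suc [1, 0]) (rename Suc ` ?\<Delta>) \<tturnstile> Falsum"
  proof (rule entails.mp)
    have "rename Suc ` \<Gamma> = \<Gamma>" using closed by force
    then show "insert (Pred p_suc [1, 0]) (rename Suc ` ?\<Delta>) \<tturnstile> rename Suc q"
      by (intro entails_mono[OF q]) (auto simp: image_Un)
  qed (simp add: entails.hyp)
  then have "?\<Delta> \<tturnstile> All (Neg (Pred p_suc [1, 0]))"
    by (intro entails_AllI) (simp only: entails_Imp_iff)
  moreover have "?\<Delta> \<tturnstile> Neg (All (Neg (Pred p_suc [1, 0])))"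
  proof -
    have "?\<Delta> \<tturnstile> inst 0 (Neg (All (Neg (Pred p_suc [1, 0]))))"
      by (rule entails_inst) (use tot in \<open>simp add: suc_total_def entails.hyp\<close>)
    then show ?thesis by (simp add: inst_def)
  qed
  ultimately show "?\<Delta> \<tturnstile> Falsum" by (rule entails.mp[rotated])
qed

text \<open>In \<open>points (n + k)\<close> the number \<open>n\<close> is variable
  \<open>k\<close>; each dropped point lowers it by one.\<close>

lemma drop_points:
  assumes closed: "\<And>p. p \<in> \<Gamma> \<Longrightarrow> rename Suc p = p" and tot: "suc_total \<in> \<Gamma>"
    and "\<Gamma> \<union> points (n + k) \<tturnstile> Pred p [k]"
  shows "\<Gamma> \<union> points n \<tturnstile> Pred p [0]"
  using assms(3)
proof (induction k)
  case (Suc k)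
  then have "\<Gamma> \<union> points (Suc (n + k)) \<tturnstile> rename Suc (Pred p [k])" by simp
  with closed tot have "\<Gamma> \<union> points (n + k) \<tturnstile> Pred p [k]" by (rule drop_point)
  then show ?case by (rule Suc.IH)
qed simp

lemma entails_pathI:
  assumes closed: "\<And>p. p \<in> \<Gamma> \<Longrightarrow> rename Suc p = p"
    and "\<Gamma> \<union> points (n + m) \<tturnstile> q"
  shows "\<Gamma> \<union> points n \<tturnstile> path m q"
  using assms(2)
proof (induction m arbitrary: n)
  case (Suc m)
  have "rename Suc ` \<Gamma> = \<Gamma>" using closed by force
  moreover have "\<Gamma> \<union> points (Suc n) \<tturnstile> path m q"
    using Suc.prems by (intro Suc.IH) simp
  ultimately have "rename Suc ` (\<Gamma> \<union> points n) \<tturnstile> Imp (Pred p_suc [1, 0]) (path m q)"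
    by (simp add: entails_Imp_iff image_Un)
  then show ?case unfolding path.simps by (rule entails_AllI)
qed simp

text \<open>Walks down the given path: \<open>i\<close> is the number reached, \<open>N - i\<close>
  its variable, and \<open>s\<close> collects the instantiations made so far.\<close>

lemma entails_pathD:
  assumes "points N \<subseteq> \<Gamma>" and "i + n \<le> N" and "s 0 = N - i"
    and "\<Gamma> \<tturnstile> rename s (path n (Pred p [0]))"
  shows "\<Gamma> \<tturnstile> Pred p [N - (i + n)]"
  using assms(2-)
proof (induction n arbitrary: i s)
  case (Suc n)
  let ?t = "case_nat (N - Suc i) (\<lambda>y. y) \<circ> case_nat 0 (\<lambda>x. Suc (s x))"
  have "\<Gamma> \<tturnstile> inst (N - Suc i) (rename (case_nat 0 (\<lambda>x. Suc (s x)))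
      (Imp (Pred p_suc [1, 0]) (path n (Pred p [0]))))"
    using Suc.prems(3) by (intro entails_inst) simp
  then have "\<Gamma> \<tturnstile> Imp (Pred p_suc [N - i, N - Suc i]) (rename ?t (path n (Pred p [0])))"
    unfolding inst_def rename_rename by (simp add: Suc.prems(2))
  moreover have "\<Gamma> \<tturnstile> Pred p_suc [N - i, N - Suc i]"
    using assms(1) points_suc[of i N] Suc.prems(1) by (auto intro: entails.hyp)
  ultimately have "\<Gamma> \<tturnstile> rename ?t (path n (Pred p [0]))" by (rule entails.mp)
  then have "\<Gamma> \<tturnstile> Pred p [N - (Suc i + n)]"
    by (rule Suc.IH[of "Suc i" ?t, rotated 2]) (use Suc.prems(1) in simp_all)
  then show ?case by simp
qed simp

lemma entails_in_class:
  assumes "points N \<subseteq> \<Gamma>" and "n \<le> N" and "\<Gamma> \<tturnstile> in_class n"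
  shows "\<Gamma> \<tturnstile> Pred p_class [N - n]"
proof -
  have "\<Gamma> \<tturnstile> inst N (Imp (Pred p_zero [0]) (path n (Pred p_class [0])))"
    using assms(3) unfolding in_class_def by (rule entails_inst)
  then have "\<Gamma> \<tturnstile> Imp (Pred p_zero [N]) (rename (case_nat N (\<lambda>y. y)) (path n (Pred p_class [0])))"
    by (simp add: inst_def)
  moreover have "\<Gamma> \<tturnstile> Pred p_zero [N]"
    using assms(1) points_zero by (auto intro: entails.hyp)
  ultimately have "\<Gamma> \<tturnstile> rename (case_nat N (\<lambda>y. y)) (path n (Pred p_class [0]))"
    by (rule entails.mp)
  then show ?thesis
    using entails_pathD[OF assms(1), of 0 n "case_nat N (\<lambda>y. y)"] assms(2) by simp
qed

lemma in_class_transfer: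
  assumes "rec_eval r [x, y] z"
  shows "insert (in_class x) (set (axioms_for r)) \<tturnstile> in_class y"
proof -
  let ?\<Gamma> = "insert (in_class x) (set (axioms_for r))"
  \<comment> \<open>Under \<open>points N\<close> the variable \<open>N - i\<close> stands for
    \<open>i\<close>, provided \<open>i \<le> N\<close>; hence only large \<open>N\<close> count. A
    clause has finitely many premises, so one \<open>N\<close> can serve them all.\<close>
  define H where "H p ns \<longleftrightarrow>
    (\<forall>\<^sub>F N in sequentially. ?\<Gamma> \<union> points N \<tturnstile> Pred p (map (\<lambda>i. N - i) ns))" for p ns
  have H_closed: "closed_under H c" if "clause_fm c \<in> ?\<Gamma>" for c
    unfolding closed_under_def
  proof (intro allI impI)
    fix s assume "\<forall>(p, xs) \<in> set (fst c). H p (map s xs)"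
    then have "\<forall>\<^sub>F N in sequentially. \<forall>a \<in> set (fst c).
        ?\<Gamma> \<union> points N \<tturnstile> Pred (fst a) (map (\<lambda>i. N - s i) (snd a))"
      by (intro eventually_ball_finite) (auto simp: H_def comp_def split_beta)
    then show "H (fst (snd c)) (map s (snd (snd c)))"
      unfolding H_def
    proof (rule eventually_mono)
      fix N assume body: "\<forall>a \<in> set (fst c).
        ?\<Gamma> \<union> points N \<tturnstile> Pred (fst a) (map (\<lambda>i. N - s i) (snd a))"
      have "closed_under (\<lambda>p xs. ?\<Gamma> \<union> points N \<tturnstile> Pred p xs) c"
        using that by (intro closed_under_entails entails.hyp) auto
      then show "?\<Gamma> \<union> points N \<tturnstile> Pred (fst (snd c)) (map (\<lambda>i. N - i) (map s (snd (snd c))))"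
        using body unfolding closed_under_def
        by (auto simp: comp_def split_beta dest!: spec[of _ "\<lambda>i. N - s i"])
    qed
  qed
  have "H (p_eval r) (z # [x, y])"
  proof (rule program_complete[OF _ _ assms])
    show "H p_zero [0]"
      using points_zero by (auto simp: H_def intro!: always_eventually entails.hyp)
    show "H p_suc [n, Suc n]" for n
      unfolding H_def using eventually_gt_at_top[of n]
      by (rule eventually_mono) (use points_suc in \<open>auto intro!: entails.hyp\<close>)
    show "\<forall>c \<in> set (program r (length [x, y])). closed_under H c"
      by (auto intro!: H_closed simp: axioms_for_def numeral_2_eq_2)
  qed
  moreover have "H p_class [x]"
    unfolding H_def using eventually_ge_at_top[of x]
    by (rule eventually_mono) (simp, rule entails_in_class, auto intro: entails.hyp)
  moreover have "closed_under H ([(p_eval r, [2, 0, 1]), (p_class, [0])], (p_class, [1]))"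
    by (rule H_closed) (simp add: axioms_for_def)
  ultimately have "H p_class (map (\<lambda>i. [x, y, z] ! i) [1])"
    by (intro closed_underD) auto
  \<comment> \<open>Some \<open>N = y + k\<close> works, where \<open>y\<close> is variable
    \<open>k\<close>. Dropping the \<open>k\<close> points beyond \<open>y\<close> leaves exactly
    the path on which \<open>in_class y\<close> makes its claim.\<close>
  then have "\<forall>\<^sub>F N in sequentially. y \<le> N \<and> ?\<Gamma> \<union> points N \<tturnstile> Pred p_class [N - y]"
    unfolding H_def by (auto intro: eventually_conj eventually_ge_at_top)
  then obtain k where k: "?\<Gamma> \<union> points (y + k) \<tturnstile> Pred p_class [k]"
    unfolding eventually_sequentially by (metis le_add_diff_inverse order_refl)
  have closed: "rename Suc p = p" if "p \<in> ?\<Gamma>" for p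
    using that rename_axioms rename_in_class by auto
  have "?\<Gamma> \<union> points y \<tturnstile> Pred p_class [0]"
    using closed k by (intro drop_points[where k = k]) (auto simp: axioms_for_def)
  then have "?\<Gamma> \<union> points 0 \<tturnstile> path y (Pred p_class [0])"
    using closed by (intro entails_pathI) auto
  moreover have "rename Suc ` ?\<Gamma> = ?\<Gamma>" using closed by force
  ultimately have "rename Suc ` ?\<Gamma> \<tturnstile> Imp (Pred p_zero [0]) (path y (Pred p_class [0]))"
    by (simp add: entails_Imp_iff)
  then show ?thesis
    unfolding in_class_def by (rule entails_AllI)
qed

lemma reduction_complete:
  assumes "rec_eval r [x, y] z"
  shows "{reduction r x} \<tturnstile> reduction r y"
proof -
  let ?\<Gamma> = "set (axioms_for r) \<union> {reduction r x}"
  have "{reduction r x} \<tturnstile> foldr Imp (axioms_for r) (in_class x)"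
    by (simp add: reduction_def entails.hyp)
  then have x: "?\<Gamma> \<tturnstile> in_class x" unfolding entails_foldr_Imp_iff .
  have "?\<Gamma> \<tturnstile> in_class y"
    using in_class_transfer[OF assms] by (rule entails_trans) (use x in \<open>auto intro: entails.hyp\<close>)
  then show ?thesis unfolding reduction_def[of r y] entails_foldr_Imp_iff .
qed

text \<open>For fixed \<open>r\<close> only \<open>in_class n\<close> varies with \<open>n\<close>,
  and the code of its path formula is given by primitive recursion on \<open>n\<close>.\<close>

lemma computable_reduction: "computable (\<lambda>n. fm_encode (reduction r n))"
proof -
  let ?q = "Pred p_class [0]" and ?S = "fm_encode (Pred p_suc [1, 0])"
  have path: "total_rec 1 (\<lambda>xs. fm_encode (path (xs ! 0) ?q))"
  proof -
    have "total_rec 1 (\<lambda>xs. rec_nat (fm_encode ?q)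
        (\<lambda>n y. (\<lambda>ys. enc_All (enc_Imp ?S (ys ! 1))) (n # y # xs)) (xs ! 0))"
      by (intro total_rec_rec_nat[where G = "\<lambda>ys. enc_All (enc_Imp ?S (ys ! 1))"]
          total_rec_intros total_rec_nth) auto
    moreover have "rec_nat (fm_encode ?q) (\<lambda>n y. enc_All (enc_Imp ?S y)) n = fm_encode (path n ?q)"
      for n
      by (induction n) (simp_all only: nat.rec path.simps fm_encode_Suc)
    ultimately show ?thesis by simp
  qed
  have "total_rec 1 (\<lambda>xs. fm_encode (foldr Imp ps (in_class (xs ! 0))))" for ps
  proof (induction ps)
    case Nil
    show ?case
      unfolding in_class_def foldr_Nil id_apply fm_encode_Suc
      by (intro total_rec_intros path[unfolded fm_encode_Suc])
  next
    case (Cons p ps)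
    then show ?case
      unfolding foldr_Cons comp_apply fm_encode_Suc(4) by (intro total_rec_intros)
  qed
  then show ?thesis
    unfolding computable_iff_total_rec reduction_def .
qed

lemma reduction_exists:
  assumes "sigma1_equiv E"
  shows "\<exists>f :: nat \<Rightarrow> fm. computable (\<lambda>n. fm_encode (f n)) \<and>
    (\<forall>x y. (x, y) \<in> E \<longleftrightarrow> \<turnstile> Iff (f x) (f y))"
proof -
  obtain r where r: "\<And>x y. (x, y) \<in> E \<longleftrightarrow> (\<exists>z. rec_eval r [x, y] z)"
    using assms by (auto simp: sigma1_equiv_def re_rel_def)
  have E: "sym E" "trans E" "(x, x) \<in> E" for x
    using assms by (auto simp: sigma1_equiv_def equiv_def refl_on_def)
  have "(x, y) \<in> E \<longleftrightarrow> \<turnstile> Iff (reduction r x) (reduction r y)" for x y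
  proof
    assume "(x, y) \<in> E"
    then have "\<exists>z. rec_eval r [x, y] z" "\<exists>z. rec_eval r [y, x] z"
      using symD[OF E(1)] unfolding r by blast+
    then show "\<turnstile> Iff (reduction r x) (reduction r y)"
      unfolding provable_Iff_iff by (blast intro: reduction_complete)
  next
    assume "\<turnstile> Iff (reduction r x) (reduction r y)"
    \<comment> \<open>The \<open>E\<close>-class of \<open>x\<close> is closed under
      \<open>E\<close> by transitivity and contains \<open>x\<close> by reflexivity.\<close>
    then have "x \<in> E `` {x} \<longleftrightarrow> y \<in> E `` {x}"
      by (rule reduction_sound) (metis Image_singleton_iff r transD[OF E(2)])
    then show "(x, y) \<in> E" using E(3) by simp
  qed
  then show ?thesis using computable_reduction by blast
qed

theorem corollary4p2:
  "complete_sigma1_equiv logical_equiv \<and>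
   (\<forall>E. sigma1_equiv E \<longrightarrow>
     (\<exists>f :: nat \<Rightarrow> fm. computable (\<lambda>n. fm_encode (f n)) \<and>
       (\<forall>x y. (x, y) \<in> E \<longleftrightarrow> \<turnstile> Iff (f x) (f y))))"
proof -
  have "(fm_encode p, fm_encode q) \<in> logical_equiv \<longleftrightarrow> \<turnstile> Iff p q" for p q
    by (auto simp: logical_equiv_def inj_eq[OF inj_fm_encode])
  then have "reducible E logical_equiv" if "sigma1_equiv E" for E
    unfolding reducible_def using reduction_exists[OF that] by metis
  then show ?thesis
    using sigma1_equiv_logical_equiv reduction_exists by (auto simp: complete_sigma1_equiv_def)
qed

end
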